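(* Let $p$ and $q$ be positive prime numbers with $p\equiv q\equiv 5 \pmod 8$. Then the equation $$2^x+p^y=q^z$$ has at most one solution in positive integers $(x,y,z)$. *)

theory Defs
  imports "HOL-Number_Theory.Number_Theory"
begin

end

theory Submission
  imports Defs "HOL-Library.Discrete_Functions" "HOL-Computational_Algebra.Nth_Powers"
begin

text \<open>
  Congruences modulo 8 leave two kinds of solutions: \<open>x = 2\<close> with \<open>y\<close> even and \<open>z\<close> odd, or
  \<open>x \<ge> 3\<close> with \<open>y\<close> and \<open>z\<close> odd. As 2 is a quadratic nonresidue modulo \<open>p\<close>, all solutions have
  the same parity of \<open>x\<close>.

  With the parities fixed, a solution reads \<open>A c\<^sup>2 + B d\<^sup>2 = q\<^sup>z\<close>, and descent shows that
  \<open>c \<surd>A + d \<surd>-B\<close> is an odd power of a generator \<open>a \<surd>A + b \<surd>-B\<close>. Since \<open>A c\<^sup>2\<close> and \<open>B d\<^sup>2\<close> are powers of 2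
  and \<open>p\<close>, \<open>2\<close>-adic and \<open>p\<close>-adic valuations together with a size comparison force the exponent to be
  1, so the generator determines the solution. This settles two solutions of the second kind; for the
  first kind it gives \<open>z = 1\<close>, where the sole exception \<open>4 + 11\<^sup>2 = 5\<^sup>3\<close> is excluded by
  \<open>p \<equiv> 5 (mod 8)\<close>.

  A solution of each kind would give \<open>q = 4 + P\<^sup>2\<close> with \<open>P\<close> an odd power of \<open>p\<close> (by congruences modulo
  3 and 5). An identity coming from the field generated by \<open>\<surd>q\<close> then yields a square that is 3
  modulo 4.
\<close>

subsection \<open>Odd powers in imaginary quadratic rings\<close>

text \<open>These are the coefficients of \<surd>C and \<surd>-D in (\<surd>C + \<surd>-D)^(2n+1).
  Only odd powers keep this shape, so the index \<open>n\<close> stands for the exponent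
  \<open>2 * n + 1\<close>; the recursion multiplies by the square C - D + 2 \<surd>-CD.\<close>

fun re_part im_part :: "int \<Rightarrow> int \<Rightarrow> nat \<Rightarrow> int" where
  "re_part C D 0 = 1"
| "re_part C D (Suc n) = (C - D) * re_part C D n - 2 * D * im_part C D n"
| "im_part C D 0 = 1"
| "im_part C D (Suc n) = (C - D) * im_part C D n + 2 * C * re_part C D n"

lemma complex_odd_power:
  fixes u v :: real
  assumes "u\<^sup>2 = of_int C" "v\<^sup>2 = of_int D"
  shows "Complex u v ^ (2 * n + 1) = Complex (u * of_int (re_part C D n)) (v * of_int (im_part C D n))"
proof (induction n)
  case (Suc n)
  have "Complex u v ^ (2 * Suc n + 1) = Complex u v ^ (2 * n + 1) * (Complex u v)\<^sup>2"
    by (simp add: power2_eq_square mult_ac)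
  also have "(Complex u v)\<^sup>2 = Complex (of_int C - of_int D) (2 * (u * v))"
    using assms by (simp add: complex_eq_iff power2_eq_square)
  also have "Complex u v ^ (2 * n + 1) * \<dots> =
      Complex (u * of_int (re_part C D (Suc n))) (v * of_int (im_part C D (Suc n)))"
    unfolding Suc.IH using assms[symmetric] by (simp add: complex_eq_iff power2_eq_square algebra_simps)
  finally show ?case .
qed simp

text \<open>The index \<open>2 * n * m + n + m\<close> belongs to the exponent (2n+1)(2m+1). The
  inner power has coordinates \<open>u * r\<close> and \<open>v * s\<close>, whose squares are the
  new parameters of the outer power.\<close>

lemma parts_mult:
  fixes C D :: int and n m :: nat
  assumes "0 < C" "0 < D"
  defines "r \<equiv> re_part C D n" and "s \<equiv> im_part C D n"
  shows "re_part C D (2 * n * m + n + m) = r * re_part (C * r\<^sup>2) (D * s\<^sup>2) m"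
    and "im_part C D (2 * n * m + n + m) = s * im_part (C * r\<^sup>2) (D * s\<^sup>2) m"
proof -
  define u v where "u = sqrt (of_int C)" and "v = sqrt (of_int D)"
  have uv: "u\<^sup>2 = of_int C" "v\<^sup>2 = of_int D" "u \<noteq> 0" "v \<noteq> 0"
    using assms by (simp_all add: u_def v_def)
  have uv': "(u * of_int r)\<^sup>2 = of_int (C * r\<^sup>2)" "(v * of_int s)\<^sup>2 = of_int (D * s\<^sup>2)"
    using uv by (simp_all add: power_mult_distrib)
  have "2 * (2 * n * m + n + m) + 1 = (2 * n + 1) * (2 * m + 1)"
    by (simp add: algebra_simps)
  then have "Complex u v ^ (2 * (2 * n * m + n + m) + 1) = (Complex u v ^ (2 * n + 1)) ^ (2 * m + 1)"
    by (simp only: power_mult)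
  then have "Complex (u * of_int (re_part C D (2 * n * m + n + m))) (v * of_int (im_part C D (2 * n * m + n + m)))
      = Complex (u * of_int r * of_int (re_part (C * r\<^sup>2) (D * s\<^sup>2) m))
          (v * of_int s * of_int (im_part (C * r\<^sup>2) (D * s\<^sup>2) m))"
    unfolding complex_odd_power[OF uv(1,2)] complex_odd_power[OF uv'] r_def[symmetric] s_def[symmetric] .
  then have "real_of_int (re_part C D (2 * n * m + n + m)) = of_int (r * re_part (C * r\<^sup>2) (D * s\<^sup>2) m)"
    "real_of_int (im_part C D (2 * n * m + n + m)) = of_int (s * im_part (C * r\<^sup>2) (D * s\<^sup>2) m)"
    using uv(3,4) by simp_all
  then show "re_part C D (2 * n * m + n + m) = r * re_part (C * r\<^sup>2) (D * s\<^sup>2) m"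
    "im_part C D (2 * n * m + n + m) = s * im_part (C * r\<^sup>2) (D * s\<^sup>2) m"
    by (simp_all only: of_int_eq_iff)
qed

lemma parts_norm:
  "C * (re_part C D n)\<^sup>2 + D * (im_part C D n)\<^sup>2 = (C + D) ^ (2 * n + 1)"
proof (induction n)
  case (Suc n)
  have "C * (re_part C D (Suc n))\<^sup>2 + D * (im_part C D (Suc n))\<^sup>2 =
      (C * (re_part C D n)\<^sup>2 + D * (im_part C D n)\<^sup>2) * (C + D)\<^sup>2"
    by (simp add: power2_eq_square algebra_simps)
  then show ?case unfolding Suc.IH by (simp add: power2_eq_square)
qed simp

lemma odd_re_part: "even C \<Longrightarrow> odd D \<Longrightarrow> odd (re_part C D n)"
  by (induction n) auto

text \<open>With D = -C both recursions become 2C times the sum of the two parts. The descent uses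
  this for a prime dividing the norm, to exclude a wrong relative sign.\<close>

lemma re_im_part_cong:
  assumes "[C + D = 0] (mod m)"
  shows "[re_part C D n = im_part C D n] (mod m)"
proof (induction n)
  case (Suc n)
  have "re_part C D (Suc n) - im_part C D (Suc n) =
    (C - D) * (re_part C D n - im_part C D n) - 2 * (C + D) * im_part C D n
     - 2 * C * (re_part C D n - im_part C D n)"
    by (simp add: algebra_simps)
  moreover have "m dvd C + D" "m dvd re_part C D n - im_part C D n"
    using assms Suc by (simp_all add: cong_iff_dvd_diff)
  ultimately show ?case
    unfolding cong_iff_dvd_diff by (metis dvd_diff dvd_mult dvd_mult2)
qed simp

section \<open>Expansions modulo powers of \<open>D\<close> and divisibility by
  \<open>p\<close>\<close>

lemma parts_cong:
  "[re_part C D n = C ^ n] (mod D) \<and> [im_part C D n = (2 * int n + 1) * C ^ n] (mod D)"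
proof (induction n)
  case (Suc n)
  then obtain k l where kl: "re_part C D n = C ^ n + D * k" "im_part C D n = (2 * int n + 1) * C ^ n + D * l"
    by (metis cong_iff_lin cong_sym)
  have "re_part C D (Suc n) - C ^ Suc n
      = D * (- (C ^ n) + (C - D) * k - 2 * im_part C D n)"
    by (simp add: kl algebra_simps)
  moreover have "im_part C D (Suc n) - (2 * int (Suc n) + 1) * C ^ Suc n
      = D * (- (2 * int n + 1) * C ^ n + (C - D) * l + 2 * C * k)"
    by (simp add: kl algebra_simps)
  ultimately show ?case by (metis cong_iff_dvd_diff dvd_triv_left)
qed simp

text \<open>The binomial expansions of both parts up to order \<open>D\<close>; the factors \<open>C\<close> and \<open>3\<close>
  clear the exponent \<open>n - 1\<close> and the denominator of \<open>(2 * n + 1) choose 3\<close>.\<close>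

lemma parts_cong_square:
  "[C * re_part C D n = C ^ (n + 1) - int n * (2 * int n + 1) * C ^ n * D] (mod D\<^sup>2) \<and>
   [3 * C * im_part C D n = 3 * (2 * int n + 1) * C ^ (n + 1)
      - (2 * int n + 1) * int n * (2 * int n - 1) * C ^ n * D] (mod D\<^sup>2)"
proof (induction n)
  case (Suc n)
  then obtain k l where kl:
    "C * re_part C D n = C ^ (n + 1) - int n * (2 * int n + 1) * C ^ n * D + D\<^sup>2 * k"
    "3 * C * im_part C D n = 3 * (2 * int n + 1) * C ^ (n + 1)
      - (2 * int n + 1) * int n * (2 * int n - 1) * C ^ n * D + D\<^sup>2 * l"
    by (metis cong_iff_lin cong_sym)
  obtain j where j: "im_part C D n = (2 * int n + 1) * C ^ n + D * j"
    using parts_cong[of C D n] by (metis cong_iff_lin cong_sym)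
  have "C * re_part C D (Suc n) = (C - D) * (C * re_part C D n) - 2 * D * C * im_part C D n"
    by (simp add: algebra_simps)
  then have "C * re_part C D (Suc n) - (C ^ (Suc n + 1) - int (Suc n) * (2 * int (Suc n) + 1) * C ^ Suc n * D)
      = D\<^sup>2 * (int n * (2 * int n + 1) * C ^ n + (C - D) * k - 2 * C * j)"
    unfolding kl j by (simp add: algebra_simps power2_eq_square)
  moreover have "3 * C * im_part C D (Suc n) = (C - D) * (3 * C * im_part C D n) + 6 * C * (C * re_part C D n)"
    by (simp add: algebra_simps)
  then have "3 * C * im_part C D (Suc n) - (3 * (2 * int (Suc n) + 1) * C ^ (Suc n + 1)
      - (2 * int (Suc n) + 1) * int (Suc n) * (2 * int (Suc n) - 1) * C ^ Suc n * D)
      = D\<^sup>2 * ((2 * int n + 1) * int n * (2 * int n - 1) * C ^ n + (C - D) * l + 6 * C * k)"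
    unfolding kl by (simp add: algebra_simps power2_eq_square)
  ultimately show ?case by (metis cong_iff_dvd_diff dvd_triv_left)
qed simp_all

text \<open>In the expansion for the exponent \<open>p\<close> the leading term contains
  \<open>p\<close> exactly once; the next one contains it twice, once from the binomial coefficient
  and once from \<open>D\<close>.\<close>

lemma not_square_dvd_im_part:
  fixes p :: nat
  assumes "prime p" "3 < p" "int p dvd D" "\<not> int p dvd C" "p = 2 * n + 1"
  shows "\<not> (int p)\<^sup>2 dvd im_part C D n"
proof
  assume *: "(int p)\<^sup>2 dvd im_part C D n"
  have "D\<^sup>2 dvd 3 * C * im_part C D n - (3 * int p * C ^ (n + 1) - int p * int n * (2 * int n - 1) * C ^ n * D)"
    using parts_cong_square[of C D n] assms(5) by (simp add: cong_iff_dvd_diff add.commute)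
  moreover have "(int p)\<^sup>2 dvd D\<^sup>2" using assms(3) by simp
  ultimately have "(int p)\<^sup>2 dvd 3 * C * im_part C D n - (3 * int p * C ^ (n + 1) - int p * int n * (2 * int n - 1) * C ^ n * D)"
    using dvd_trans by blast
  then have "(int p)\<^sup>2 dvd 3 * int p * C ^ (n + 1) - int p * int n * (2 * int n - 1) * C ^ n * D"
    using * by (metis dvd_mult dvd_diff_commute dvd_diff_left_iff)
  moreover have "(int p)\<^sup>2 dvd int p * int n * (2 * int n - 1) * C ^ n * D"
    using mult_dvd_mono[OF dvd_triv_left[of "int p" "int n * (2 * int n - 1) * C ^ n"] assms(3)]
    by (simp add: power2_eq_square mult.assoc)
  ultimately have "(int p)\<^sup>2 dvd 3 * int p * C ^ (n + 1)"
    by (metis diff_add_cancel dvd_add)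
  then have "int p dvd 3 * C ^ (n + 1)"
    using assms(2) by (auto simp: power2_eq_square mult.assoc mult.left_commute)
  moreover have "prime (int p)" using assms(1) by simp
  ultimately have "int p dvd 3 \<or> int p dvd C"
    using prime_dvd_mult_iff prime_dvd_power by metis
  then show False using assms(2,4) zdvd_imp_le[of "int p" 3] by auto
qed

text \<open>If \<open>p\<close> does not divide the exponent, the imaginary part is prime to
  \<open>p\<close> and hence a unit, so the norm stays C + D. Otherwise the element is a
  \<open>p\<close>-th power, whose imaginary part gains at most one factor \<open>p\<close>, too
  little for the growth of the norm.\<close>

lemma parts_prime_power_unit:
  fixes p :: nat
  assumes "prime p" "3 < p" "0 < C" "0 < D" "int p dvd D" "\<not> int p dvd C"
    and re: "(re_part C D n)\<^sup>2 = 1" and im: "im_part C D n dvd int p ^ w"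
  shows "n = 0"
proof (cases "p dvd 2 * n + 1")
  case False
  have pp: "prime (int p)" using assms(1) by simp
  have "\<not> int p dvd (2 * int n + 1) * C ^ n"
  proof
    assume "int p dvd (2 * int n + 1) * C ^ n"
    then have "int p dvd 2 * int n + 1 \<or> int p dvd C"
      using prime_dvd_mult_iff[OF pp] prime_dvd_power[OF pp] by blast
    then have "int p dvd int (2 * n + 1)" using assms(6) by (simp add: add.commute)
    then show False using False by (simp only: of_nat_dvd_iff)
  qed
  moreover have "[im_part C D n = (2 * int n + 1) * C ^ n] (mod (int p))"
    using parts_cong assms(5) cong_dvd_modulus by blast
  ultimately have "\<not> int p dvd im_part C D n"
    using cong_dvd_iff by blast
  then have "coprime (im_part C D n) (int p ^ w)"
    using pp by (simp add: prime_imp_coprime coprime_commute)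
  then have "is_unit (im_part C D n)"
    using im by (meson coprime_common_divisor dvd_refl)
  then have "(im_part C D n)\<^sup>2 = 1" by (simp add: power2_eq_1_iff abs_eq_iff')
  then have "(C + D) ^ (2 * n + 1) = (C + D) ^ 1"
    using parts_norm[of C D n] re by simp
  moreover have "1 < C + D" using assms by linarith
  ultimately have "2 * n + 1 = 1"
    using power_inject_exp by blast
  then show ?thesis by simp
next
  case True
  have pp: "prime (int p)" using assms(1) by simp
  from True obtain m where m: "2 * n + 1 = p * m" by blast
  then have "odd (p * m)" by (metis even_mult_iff odd_two_times_div_two_succ odd_add odd_one dvd_triv_left)
  then have "odd p" "odd m" by simp_all
  then obtain j k where jk: "p = 2 * j + 1" "m = 2 * k + 1" by (meson oddE)
  \<comment> \<open>The exponent is \<open>p * m\<close>: first take the \<open>m\<close>-th power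
    (index \<open>k\<close>), then its \<open>p\<close>-th power (index \<open>j\<close>).\<close>
  have n: "n = 2 * k * j + k + j" using m unfolding jk by (simp add: algebra_simps)
  define r s where "r = re_part C D k" and "s = im_part C D k"
  define r' t where "r' = re_part (C * r\<^sup>2) (D * s\<^sup>2) j" and "t = im_part (C * r\<^sup>2) (D * s\<^sup>2) j"
  have re': "re_part C D n = r * r'" and im': "im_part C D n = s * t"
    using parts_mult[OF assms(3,4), of k j] unfolding n r_def s_def r'_def t_def by auto
  have "(r * r') * (r * r') = 1" using re unfolding re' power2_eq_square .
  then have "is_unit r" "is_unit r'"
    by (metis dvd_triv_left mult.assoc, metis dvd_triv_left mult.assoc mult.commute)
  then have r: "r\<^sup>2 = 1" "r'\<^sup>2 = 1" by (simp_all add: power2_eq_1_iff abs_eq_iff')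
  have t: "t dvd int p ^ w" using im unfolding im' by (rule dvd_mult_right)
  then obtain i where i: "\<bar>t\<bar> = int p ^ i"
    using divides_primepow[OF pp, of t w] by auto
  have nd: "int p dvd D * s\<^sup>2" "\<not> int p dvd C * r\<^sup>2" using assms(5,6) r by simp_all
  have "\<not> (int p)\<^sup>2 dvd t"
    unfolding t_def by (rule not_square_dvd_im_part[OF assms(1,2) nd jk(1)])
  then have "\<not> 2 \<le> i" using i by (metis dvd_abs_iff le_imp_power_dvd)
  then have "i \<le> 1" by simp
  then have "\<bar>t\<bar> \<le> int p ^ 1"
    unfolding i using assms(2) by (intro power_increasing) auto
  then have t2: "t\<^sup>2 \<le> (int p)\<^sup>2" by (metis abs_ge_zero power2_abs power_mono power_one_right)
  have "s \<noteq> 0"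
  proof
    assume "s = 0"
    then have "int p ^ w = 0" using im im' by simp
    then show False using assms(2) by simp
  qed
  define D' where "D' = D * s\<^sup>2"
  have "0 < D'" using assms(4) \<open>s \<noteq> 0\<close> by (simp add: D'_def)
  then have D': "int p \<le> D'" using nd(1) zdvd_imp_le D'_def by blast
  \<comment> \<open>The norm of the \<open>p\<close>-th power is below (C + D')^3, because
    \<open>t\<close> is at most \<open>p\<close> in absolute value and p < C + D'.\<close>
  have "(C + D') ^ p = C + D' * t\<^sup>2"
    using parts_norm[of "C * r\<^sup>2" "D * s\<^sup>2" j] r
    unfolding r'_def[symmetric] t_def[symmetric] D'_def jk(1)[symmetric] by simp
  also have "\<dots> \<le> C * (int p)\<^sup>2 + D' * (int p)\<^sup>2"
    using assms(2,3) \<open>0 < D'\<close> t2 by (intro add_mono mult_left_mono) (auto simp: one_le_power)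
  also have "\<dots> = (C + D') * (int p)\<^sup>2" by (simp add: algebra_simps)
  also have "\<dots> < (C + D') * (C + D')\<^sup>2"
    using assms(2,3) D' by (intro mult_strict_left_mono power_strict_mono) auto
  also have "\<dots> = (C + D') ^ 3" by (simp add: power2_eq_square power3_eq_cube)
  also have "\<dots> \<le> (C + D') ^ p"
    using assms(2,3) D' by (intro power_increasing) auto
  finally show ?thesis by simp
qed

subsection \<open>Descent for binary quadratic forms\<close>

lemma prime_not_dvd_square_mult:
  fixes q :: int
  assumes "prime q" "\<not> q dvd A" "\<not> q dvd c"
  shows "\<not> q dvd A * c\<^sup>2"
  using assms by (simp add: prime_dvd_mult_iff prime_dvd_power_iff)

lemma prime_not_dvd_binary_form:
  fixes q :: int
  assumes "prime q" "\<not> q dvd A" "\<not> q dvd B" "A * c\<^sup>2 + B * d\<^sup>2 = q ^ z" "0 < z"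
  shows "q dvd c \<longleftrightarrow> q dvd d"
proof -
  have "q dvd A * c\<^sup>2 + B * d\<^sup>2" using assms(4,5) by simp
  then have "q dvd A * c\<^sup>2 \<longleftrightarrow> q dvd B * d\<^sup>2"
    by (metis dvd_add_right_iff dvd_add_left_iff)
  then show ?thesis using assms(1-3) by (simp add: prime_dvd_mult_iff prime_dvd_power_iff)
qed

lemma prime_power_dvd_factor:
  fixes q :: int
  assumes "prime q" "q ^ m dvd x * y" "\<not> q dvd x"
  shows "q ^ m dvd y"
proof -
  have "coprime (q ^ m) x" using assms(1,3) by (simp add: prime_imp_coprime)
  then show ?thesis using assms(2) coprime_dvd_mult_right_iff by blast
qed

text \<open>Division of \<open>c \<surd>A + d \<surd>-B\<close> by the square of
  \<open>a \<surd>A + b \<surd>-B\<close>: after replacing the former by its conjugate if necessary (the sign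
  \<open>e\<close>), the product with the conjugate square is divisible by \<open>q ^ min z (2 * g)\<close>.\<close>

lemma binary_form_division:
  fixes q :: int
  assumes q: "prime q" "\<not> q dvd 2" "\<not> q dvd A" "\<not> q dvd B"
    and \<gamma>: "A * a\<^sup>2 + B * b\<^sup>2 = q ^ g" "0 < g" "\<not> q dvd a"
    and \<alpha>: "A * c\<^sup>2 + B * d\<^sup>2 = q ^ z" "0 < z" "\<not> q dvd c"
  defines "\<mu> \<equiv> min z (2 * g)"
  defines "U \<equiv> A * a\<^sup>2 - B * b\<^sup>2" and "V \<equiv> 2 * a * b"
  obtains e c' d' where "e\<^sup>2 = 1" "c * U + e * B * d * V = q ^ \<mu> * c'" "e * d * U - A * c * V = q ^ \<mu> * d'"
    "A * c'\<^sup>2 + B * d'\<^sup>2 = q ^ (z + 2 * g - 2 * \<mu>)"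
proof -
  have b: "\<not> q dvd b" and d: "\<not> q dvd d"
    using prime_not_dvd_binary_form[OF q(1,3,4)] \<gamma> \<alpha> by blast+
  have norm: "U\<^sup>2 + A * B * V\<^sup>2 = q ^ (2 * g)"
  proof -
    have "U\<^sup>2 + A * B * V\<^sup>2 = (A * a\<^sup>2 + B * b\<^sup>2)\<^sup>2"
      unfolding U_def V_def by (simp add: power2_eq_square algebra_simps)
    then show ?thesis unfolding \<gamma>(1) by (simp flip: power_mult add: mult.commute)
  qed
  have qU: "\<not> q dvd U"
  proof
    assume "q dvd U"
    moreover have "q dvd A * a\<^sup>2 + B * b\<^sup>2" using \<gamma> by simp
    ultimately have "q dvd U + (A * a\<^sup>2 + B * b\<^sup>2)" by (rule dvd_add)
    also have "\<dots> = 2 * (A * a\<^sup>2)" by (simp add: U_def)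
    finally show False
      using q \<gamma>(3) prime_not_dvd_square_mult by (simp add: prime_dvd_mult_iff prime_dvd_power_iff)
  qed
  \<comment> \<open>Both terms on the right are divisible by \<open>q ^ \<mu>\<close>. As
    \<open>q\<close> cannot divide both factors on the left, one factor absorbs the whole power, and
    this choice fixes the sign \<open>e\<close>.\<close>
  have prod: "B * ((d * U + A * c * V) * (d * U - A * c * V)) = q ^ z * U\<^sup>2 - A * c\<^sup>2 * q ^ (2 * g)"
    unfolding norm[symmetric] \<alpha>(1)[symmetric] by (simp add: power2_eq_square algebra_simps)
  have "q ^ \<mu> dvd q ^ z" "q ^ \<mu> dvd q ^ (2 * g)" by (simp_all add: \<mu>_def le_imp_power_dvd)
  then have "q ^ \<mu> dvd B * ((d * U + A * c * V) * (d * U - A * c * V))"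
    unfolding prod by (intro dvd_diff dvd_mult dvd_mult2)
  then have dvd: "q ^ \<mu> dvd (d * U + A * c * V) * (d * U - A * c * V)"
    using prime_power_dvd_factor q(1,4) by blast
  have "\<exists>e. e\<^sup>2 = 1 \<and> q ^ \<mu> dvd e * d * U - A * c * V"
  proof (cases "q dvd d * U + A * c * V")
    case False
    then have "q ^ \<mu> dvd d * U - A * c * V" using dvd prime_power_dvd_factor q(1) by blast
    then show ?thesis by (intro exI[of _ 1]) simp
  next
    case True
    have "\<not> q dvd d * U - A * c * V"
    proof
      assume "q dvd d * U - A * c * V"
      from dvd_add[OF this True] have "q dvd 2 * (d * U)" by (simp add: algebra_simps)
      then show False using q d qU by (simp add: prime_dvd_mult_iff)
    qed
    moreover have "q ^ \<mu> dvd (d * U - A * c * V) * (d * U + A * c * V)" using dvd by (simp add: mult.commute)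
    ultimately have "q ^ \<mu> dvd d * U + A * c * V" using prime_power_dvd_factor q(1) by blast
    then have "q ^ \<mu> dvd - (d * U + A * c * V)" by (simp only: dvd_minus_iff)
    then show ?thesis by (intro exI[of _ "-1"]) (simp add: algebra_simps)
  qed
  then obtain e d' where e: "e\<^sup>2 = 1" and d': "e * d * U - A * c * V = q ^ \<mu> * d'" by blast
  \<comment> \<open>Brahmagupta's identity; it carries the divisibility from the second coordinate
    over to the first.\<close>
  have "A * (c * U + e * B * d * V)\<^sup>2 + B * (e * d * U - A * c * V)\<^sup>2
      = (A * c\<^sup>2 + e\<^sup>2 * B * d\<^sup>2) * (U\<^sup>2 + A * B * V\<^sup>2)"
    by (simp add: power2_eq_square algebra_simps)
  then have nrm: "A * (c * U + e * B * d * V)\<^sup>2 + B * (e * d * U - A * c * V)\<^sup>2 = q ^ (z + 2 * g)"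
    unfolding norm e by (simp add: \<alpha>(1) power_add)
  have le: "2 * \<mu> \<le> z + 2 * g" by (auto simp: \<mu>_def)
  then have "q ^ (2 * \<mu>) dvd q ^ (z + 2 * g)" by (rule le_imp_power_dvd)
  moreover have "q ^ (2 * \<mu>) dvd B * (e * d * U - A * c * V)\<^sup>2"
    unfolding d' by (simp add: power_mult_distrib power_even_eq)
  ultimately have "q ^ (2 * \<mu>) dvd A * (c * U + e * B * d * V)\<^sup>2"
    unfolding nrm[symmetric] using dvd_add_left_iff by blast
  then have "q ^ (2 * \<mu>) dvd (c * U + e * B * d * V)\<^sup>2"
    using prime_power_dvd_factor q(1,3) by blast
  then have "(q ^ \<mu>)\<^sup>2 dvd (c * U + e * B * d * V)\<^sup>2"
    by (simp add: power_even_eq)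
  then have "q ^ \<mu> dvd c * U + e * B * d * V" by simp
  then obtain c' where c': "c * U + e * B * d * V = q ^ \<mu> * c'" by blast
  have "q ^ (2 * \<mu>) * (A * c'\<^sup>2 + B * d'\<^sup>2) = q ^ (z + 2 * g)"
    using nrm unfolding c' d' power_even_eq[of q \<mu>] by (simp add: power_mult_distrib algebra_simps)
  also have "\<dots> = q ^ (2 * \<mu>) * q ^ (z + 2 * g - 2 * \<mu>)"
    using le by (simp flip: power_add)
  finally have "A * c'\<^sup>2 + B * d'\<^sup>2 = q ^ (z + 2 * g - 2 * \<mu>)"
    using q(1) by auto
  with e c' d' show ?thesis by (rule that)
qed

text \<open>Up to conjugation, the quotient of the two elements has imaginary coordinate
  \<open>W\<close> divided by \<open>q ^ z\<close>. Here \<open>q ^ z\<close> divides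
  \<open>W\<close>, while A B W^2 is at most q^(2z), so A B > 1 forces W = 0. For A = B = 1 one
  could swap \<open>a\<close> and \<open>b\<close>.\<close>

lemma binary_form_same_norm:
  fixes q :: int
  assumes q: "prime q" "\<not> q dvd 2" "\<not> q dvd A" "\<not> q dvd B" and AB: "0 < A" "0 < B" "1 < A * B"
    and \<gamma>: "A * a\<^sup>2 + B * b\<^sup>2 = q ^ z" "0 < z" "\<not> q dvd a"
    and \<alpha>: "A * c\<^sup>2 + B * d\<^sup>2 = q ^ z" "\<not> q dvd c"
  shows "\<bar>c\<bar> = \<bar>a\<bar>" "\<bar>d\<bar> = \<bar>b\<bar>"
proof -
  have b: "\<not> q dvd b" and d: "\<not> q dvd d"
    using prime_not_dvd_binary_form[OF q(1,3,4)] \<gamma> \<alpha> by blast+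
  have "A * ((b * c + a * d) * (b * c - a * d)) = q ^ z * (b\<^sup>2 - d\<^sup>2)"
  proof -
    have "A * ((b * c + a * d) * (b * c - a * d)) = b\<^sup>2 * (A * c\<^sup>2 + B * d\<^sup>2) - d\<^sup>2 * (A * a\<^sup>2 + B * b\<^sup>2)"
      by (simp add: power2_eq_square algebra_simps)
    then show ?thesis unfolding \<gamma>(1) \<alpha>(1) by (simp add: algebra_simps)
  qed
  then have "q ^ z dvd A * ((b * c + a * d) * (b * c - a * d))" by simp
  then have dvd: "q ^ z dvd (b * c + a * d) * (b * c - a * d)"
    using prime_power_dvd_factor q(1,3) by blast
  have "\<exists>e. e\<^sup>2 = 1 \<and> q ^ z dvd b * c - e * (a * d)"
  proof (cases "q dvd b * c + a * d")
    case False
    then have "q ^ z dvd b * c - a * d" using dvd prime_power_dvd_factor q(1) by blast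
    then show ?thesis by (intro exI[of _ 1]) simp
  next
    case True
    have "\<not> q dvd b * c - a * d"
    proof
      assume "q dvd b * c - a * d"
      from dvd_add[OF this True] have "q dvd 2 * (b * c)" by (simp add: algebra_simps)
      then show False using q b \<alpha>(2) by (simp add: prime_dvd_mult_iff)
    qed
    moreover have "q ^ z dvd (b * c - a * d) * (b * c + a * d)" using dvd by (simp add: mult.commute)
    ultimately have "q ^ z dvd b * c + a * d" using prime_power_dvd_factor q(1) by blast
    then show ?thesis by (intro exI[of _ "-1"]) simp
  qed
  then obtain e where e: "e\<^sup>2 = 1" and dvd: "q ^ z dvd b * c - e * (a * d)" by blast
  define W where "W = b * c - e * (a * d)"
  have ee: "e * e = 1" using e by (simp add: power2_eq_square)
  have nrm: "(A * a * c + e * B * b * d)\<^sup>2 + A * B * W\<^sup>2 = (q ^ z)\<^sup>2"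
  proof -
    have "(A * a * c + e * B * b * d)\<^sup>2 + A * B * W\<^sup>2
        = (A * c\<^sup>2 + (e * e) * B * d\<^sup>2) * (A * a\<^sup>2 + B * b\<^sup>2)"
      unfolding W_def by (simp add: power2_eq_square algebra_simps)
    then show ?thesis unfolding ee \<gamma>(1) using \<alpha>(1) by (simp add: power2_eq_square)
  qed
  have W: "W = 0"
  proof (rule ccontr)
    assume "W \<noteq> 0"
    have "q ^ z dvd W" using dvd by (simp add: W_def)
    then have "(q ^ z)\<^sup>2 \<le> W\<^sup>2"
      using \<open>W \<noteq> 0\<close> by (intro zdvd_imp_le) simp_all
    moreover have "1 * W\<^sup>2 < A * B * W\<^sup>2"
      using AB \<open>W \<noteq> 0\<close> by (intro mult_strict_right_mono) simp_all
    ultimately show False using nrm by (smt (verit) zero_le_power2)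
  qed
  define M where "M = A * a * c + e * B * b * d"
  have "(A * a\<^sup>2 + B * b\<^sup>2) * c - M * a = B * b * W"
    unfolding M_def W_def by (simp add: power2_eq_square algebra_simps)
  then have "q ^ z * c = M * a" unfolding \<gamma>(1) W by simp
  moreover have "M\<^sup>2 = (q ^ z)\<^sup>2" using nrm W by (simp add: M_def)
  then have "\<bar>M\<bar> = \<bar>q ^ z\<bar>" by (metis power2_eq_iff abs_minus_cancel)
  ultimately have "\<bar>q ^ z\<bar> * \<bar>c\<bar> = \<bar>q ^ z\<bar> * \<bar>a\<bar>" by (metis abs_mult)
  then show c: "\<bar>c\<bar> = \<bar>a\<bar>" using q(1) by auto
  then have "c\<^sup>2 = a\<^sup>2" by (metis power2_abs)
  then have "B * d\<^sup>2 = B * b\<^sup>2" using \<gamma>(1) \<alpha>(1) by (metis add_left_imp_eq)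
  then have "d\<^sup>2 = b\<^sup>2" using AB(2) by auto
  then show "\<bar>d\<bar> = \<bar>b\<bar>" by (metis power2_eq_iff abs_minus_cancel)
qed

text \<open>Infinite descent: dividing by \<open>\<gamma>\<^sup>2\<close>, where \<open>\<gamma>\<close> has the least possible odd exponent
  \<open>g\<close>, shows that up to sign and conjugation every element is an odd power of \<open>\<gamma>\<close>.\<close>

lemma binary_form_odd_power:
  fixes q :: int
  assumes q: "prime q" "\<not> q dvd 2" "\<not> q dvd A" "\<not> q dvd B" and AB: "0 < A" "0 < B" "1 < A * B"
    and \<gamma>: "A * a\<^sup>2 + B * b\<^sup>2 = q ^ g" "odd g" "\<not> q dvd a"
    and min: "\<forall>h c d. odd h \<longrightarrow> A * c\<^sup>2 + B * d\<^sup>2 = q ^ h \<longrightarrow> g \<le> h"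
    and \<alpha>: "A * c\<^sup>2 + B * d\<^sup>2 = q ^ z" "odd z" "\<not> q dvd c"
  shows "\<exists>n. \<bar>c\<bar> = \<bar>a * re_part (A * a\<^sup>2) (B * b\<^sup>2) n\<bar> \<and> \<bar>d\<bar> = \<bar>b * im_part (A * a\<^sup>2) (B * b\<^sup>2) n\<bar>"
  using \<alpha>
proof (induction z arbitrary: c d rule: less_induct)
  case (less z c d)
  let ?r = "re_part (A * a\<^sup>2) (B * b\<^sup>2)" and ?s = "im_part (A * a\<^sup>2) (B * b\<^sup>2)"
  define U V where "U = A * a\<^sup>2 - B * b\<^sup>2" and "V = 2 * a * b"
  have g: "0 < g" and z: "0 < z" using \<gamma>(2) less.prems(2) by (auto intro: odd_pos)
  have gz: "g \<le> z" using min less.prems by blast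
  obtain e c' d' where e: "e\<^sup>2 = 1"
    and c': "c * U + e * B * d * V = q ^ min z (2 * g) * c'"
    and d': "e * d * U - A * c * V = q ^ min z (2 * g) * d'"
    and nrm: "A * c'\<^sup>2 + B * d'\<^sup>2 = q ^ (z + 2 * g - 2 * min z (2 * g))"
    using binary_form_division[OF q \<gamma>(1) g \<gamma>(3) less.prems(1) z less.prems(3)]
    unfolding U_def V_def by metis
  \<comment> \<open>The value 2g is excluded because \<open>z\<close> is odd.\<close>
  consider "z = g" | "g < z" "z < 2 * g" | "2 * g < z"
    using gz less.prems(2) by (cases z "2 * g" rule: linorder_cases) fastforce+
  then show ?case
  proof cases
    case 1
    then have "\<bar>c\<bar> = \<bar>a\<bar>" "\<bar>d\<bar> = \<bar>b\<bar>"
      using binary_form_same_norm[OF q AB] \<gamma> g less.prems by blast+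
    then show ?thesis by (intro exI[of _ 0]) simp
  next
    case 2
    \<comment> \<open>The quotient would have the odd exponent 2g - z, below the minimum
      \<open>g\<close>.\<close>
    then have "A * c'\<^sup>2 + B * d'\<^sup>2 = q ^ (2 * g - z)" using nrm by (simp add: min_def)
    moreover have "odd (2 * g - z)" using less.prems(2) 2 by simp
    ultimately have "g \<le> 2 * g - z" using min by blast
    then show ?thesis using 2 by linarith
  next
    case 3
    then have m: "min z (2 * g) = 2 * g" by simp
    have nrm': "A * c'\<^sup>2 + B * d'\<^sup>2 = q ^ (z - 2 * g)" using nrm 3 unfolding m by simp
    have norm: "U * U + A * B * V * V = q ^ (2 * g)"
    proof -
      have "U * U + A * B * V * V = (A * a\<^sup>2 + B * b\<^sup>2)\<^sup>2"
        unfolding U_def V_def by (simp add: power2_eq_square algebra_simps)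
      then show ?thesis unfolding \<gamma>(1) by (simp flip: power_mult add: mult.commute)
    qed
    \<comment> \<open>Multiplying back by \<gamma>^2 recovers \<open>c\<close> and
      \<open>e * d\<close> from the quotient.\<close>
    have "q ^ (2 * g) * c = c * (U * U + A * B * V * V)" unfolding norm by simp
    also have "\<dots> = U * (c * U + e * B * d * V) - B * V * (e * d * U - A * c * V)"
      by (simp add: algebra_simps)
    also have "\<dots> = q ^ (2 * g) * (c' * U - B * V * d')" unfolding c' d' m by (simp add: algebra_simps)
    finally have c: "c = c' * U - B * V * d'" using q(1) by auto
    have "q ^ (2 * g) * (e * d) = e * d * (U * U + A * B * V * V)" unfolding norm by simp
    also have "\<dots> = U * (e * d * U - A * c * V) + A * V * (c * U + e * B * d * V)"
      by (simp add: algebra_simps)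
    also have "\<dots> = q ^ (2 * g) * (d' * U + A * V * c')" unfolding c' d' m by (simp add: algebra_simps)
    finally have d: "e * d = d' * U + A * V * c'" using q(1) by auto
    have "\<bar>e\<bar> = 1" using e by (auto simp: power2_eq_1_iff)
    then have absd: "\<bar>d\<bar> = \<bar>e * d\<bar>" by (simp add: abs_mult)
    have "\<not> q dvd c'"
    proof
      assume "q dvd c'"
      then have "q dvd d'" using prime_not_dvd_binary_form[OF q(1,3,4) nrm'] 3 by simp
      with \<open>q dvd c'\<close> have "q dvd c" unfolding c by simp
      then show False using less.prems(3) by simp
    qed
    moreover have "odd (z - 2 * g)" "z - 2 * g < z" using less.prems(2) 3 g by simp_all
    ultimately obtain n where n: "\<bar>c'\<bar> = \<bar>a * ?r n\<bar>" "\<bar>d'\<bar> = \<bar>b * ?s n\<bar>"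
      using less.IH[OF _ nrm'] by blast
    have sign: "\<exists>u. x = u * y \<and> \<bar>u\<bar> = 1" if "\<bar>x\<bar> = \<bar>y\<bar>" for x y :: int
    proof (cases "x = y")
      case False
      then have "x = - 1 * y" using that by linarith
      then show ?thesis by (intro exI[of _ "- 1"]) simp
    qed (intro exI[of _ 1], simp)
    obtain u v where u: "c' = u * (a * ?r n)" "\<bar>u\<bar> = 1" and v: "d' = v * (b * ?s n)" "\<bar>v\<bar> = 1"
      using sign[OF n(1)] sign[OF n(2)] by blast
    show ?thesis
    proof (cases "u = v")
      case True
      have "c = u * (a * ?r (Suc n))"
        unfolding c u(1) v(1) True U_def V_def by (simp add: power2_eq_square algebra_simps)
      moreover have "e * d = u * (b * ?s (Suc n))"
        unfolding d u(1) v(1) True U_def V_def by (simp add: power2_eq_square algebra_simps)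
      ultimately show ?thesis using u(2) absd by (metis abs_mult mult_1)
    next
      case False
      then have v': "v = - u" using u(2) v(2) by linarith
      \<comment> \<open>Opposite signs would multiply a power of \<gamma> by the square of the
        conjugate, which makes \<open>c\<close> divisible by \<open>q\<close>.\<close>
      have "c = u * a * ((A * a\<^sup>2 + B * b\<^sup>2) * ?r n - 2 * (B * b\<^sup>2) * (?r n - ?s n))"
        unfolding c u(1) v(1) v' U_def V_def by (simp add: power2_eq_square algebra_simps)
      moreover have "q dvd A * a\<^sup>2 + B * b\<^sup>2" using \<gamma>(1) g by simp
      moreover from this have "q dvd ?r n - ?s n"
        using re_im_part_cong by (simp add: cong_iff_dvd_diff)
      ultimately have "q dvd c" by (metis dvd_diff dvd_mult dvd_mult2)
      then show ?thesis using less.prems(3) by simp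
    qed
  qed
qed

text \<open>Take the least odd exponent that is represented. A common factor \<open>q\<close> of
  both coordinates could be divided out, lowering the exponent by 2.\<close>

lemma binary_form_generator:
  fixes q :: int
  assumes q: "prime q" "\<not> q dvd A" "\<not> q dvd B"
    and \<alpha>: "A * c\<^sup>2 + B * d\<^sup>2 = q ^ z" "odd z"
  obtains a b g where "A * a\<^sup>2 + B * b\<^sup>2 = q ^ g" "odd g" "\<not> q dvd a"
    "\<forall>h c d. odd h \<longrightarrow> A * c\<^sup>2 + B * d\<^sup>2 = q ^ h \<longrightarrow> g \<le> h"
proof -
  define P where "P h \<longleftrightarrow> odd h \<and> (\<exists>c d. A * c\<^sup>2 + B * d\<^sup>2 = q ^ h)" for h
  define g where "g = (LEAST h. P h)"
  have "P z" using \<alpha> P_def by blast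
  then have "P g" and min: "\<And>h. P h \<Longrightarrow> g \<le> h"
    unfolding g_def by (rule LeastI, simp add: Least_le)
  then obtain a b where g: "odd g" and ab: "A * a\<^sup>2 + B * b\<^sup>2 = q ^ g" using P_def by blast
  have "\<not> q dvd a"
  proof
    assume a: "q dvd a"
    then have "q dvd b" using prime_not_dvd_binary_form[OF q ab] g odd_pos by blast
    with a obtain a' b' where ab': "a = q * a'" "b = q * b'" by blast
    then have eq: "q\<^sup>2 * (A * a'\<^sup>2 + B * b'\<^sup>2) = q ^ g"
      using ab by (simp add: power_mult_distrib algebra_simps)
    have "2 \<le> g"
    proof (rule ccontr)
      assume "\<not> 2 \<le> g"
      then have "g = 1" using g odd_pos by fastforce
      then have "q * (q * (A * a'\<^sup>2 + B * b'\<^sup>2)) = q * 1" using eq by (simp add: power2_eq_square mult.assoc)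
      then have "q * (A * a'\<^sup>2 + B * b'\<^sup>2) = 1" using q(1) mult_cancel_left not_prime_0 by metis
      then have "is_unit q" by (metis dvd_triv_left)
      then show False using q(1) not_prime_unit by blast
    qed
    then have "q ^ g = q\<^sup>2 * q ^ (g - 2)" by (metis le_add_diff_inverse power_add)
    then have "A * a'\<^sup>2 + B * b'\<^sup>2 = q ^ (g - 2)" using eq q(1) by auto
    then have "P (g - 2)" using g \<open>2 \<le> g\<close> unfolding P_def by auto
    then show False using min[of "g - 2"] \<open>2 \<le> g\<close> by simp
  qed
  with ab g min show ?thesis unfolding P_def by (intro that) blast+
qed

subsection \<open>Quadratic residues and sums of two squares\<close>

text \<open>As p = 1 mod 4, there is \<open>i\<close> with i^2 = -1 mod \<open>p\<close>, and f = 1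
  + i satisfies f^4 = -4. Euler's criterion for the square f^2 gives 1 = (-4)^(2k+1) =
  -(2^((p-1)/2)); for a residue 2 the right side would be -1.\<close>

lemma two_nonresidue:
  fixes p :: nat
  assumes "prime p" "p mod 8 = 5"
  shows "\<not> QuadRes (int p) 2"
proof
  assume two: "QuadRes (int p) 2"
  obtain k where k: "p = 8 * k + 5"
    using assms(2) by (metis mult_div_mod_eq)
  have h: "(p - 1) div 2 = 2 * (2 * k + 1)" by (simp add: k)
  have euler: "[Legendre a (int p) = a ^ (2 * (2 * k + 1))] (mod int p)" for a
    using euler_criterion[of p a] assms(1) unfolding h by (simp add: k)
  have res: "[a ^ (2 * (2 * k + 1)) = 1] (mod int p)" if "QuadRes (int p) a" "\<not> [a = 0] (mod int p)" for a
    using euler[of a] that by (simp add: Legendre_def cong_sym)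
  have ndvd: "\<not> int p dvd 2" "\<not> int p dvd 4"
    using zdvd_imp_le[of "int p" 2] zdvd_imp_le[of "int p" 4] by (auto simp: k)
  have "[Legendre (- 1) (int p) = 1] (mod int p)"
    using euler[of "- 1"] by simp
  moreover have "\<not> [-1 = (1::int)] (mod int p)" "\<not> [0 = (1::int)] (mod int p)"
    using ndvd by (auto simp: cong_iff_dvd_diff k)
  ultimately have "QuadRes (int p) (- 1)"
    by (auto simp: Legendre_def split: if_splits)
  then obtain i where i: "[i\<^sup>2 = - 1] (mod int p)" unfolding QuadRes_def by blast
  define f where "f = 1 + i"
  have "f\<^sup>2 = (i\<^sup>2 + 1) + 2 * i" by (simp add: f_def power2_eq_square algebra_simps)
  also have "[\<dots> = (- 1 + 1) + 2 * i] (mod int p)"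
    by (intro cong_add i cong_refl)
  finally have "[(f\<^sup>2)\<^sup>2 = (2 * i)\<^sup>2] (mod int p)" by (intro cong_pow) simp
  also have "(2 * i)\<^sup>2 = 4 * i\<^sup>2" by (simp add: power2_eq_square)
  also have "[4 * i\<^sup>2 = 4 * (- 1)] (mod int p)" by (intro cong_mult i cong_refl)
  finally have f: "[(f\<^sup>2)\<^sup>2 = - 4] (mod int p)" by simp
  have "\<not> [f\<^sup>2 = 0] (mod int p)"
  proof
    assume "[f\<^sup>2 = 0] (mod int p)"
    then have "[(f\<^sup>2)\<^sup>2 = 0\<^sup>2] (mod int p)" by (rule cong_pow)
    then have "[- 4 = 0] (mod int p)" using f by (metis cong_sym cong_trans zero_power2)
    then show False using ndvd by (simp add: cong_iff_dvd_diff)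
  qed
  moreover have "QuadRes (int p) (f\<^sup>2)" unfolding QuadRes_def using cong_refl by blast
  ultimately have "[(f\<^sup>2) ^ (2 * (2 * k + 1)) = 1] (mod int p)" using res by blast
  then have "[((f\<^sup>2)\<^sup>2) ^ (2 * k + 1) = 1] (mod int p)" by (simp only: power_mult)
  moreover have "[((f\<^sup>2)\<^sup>2) ^ (2 * k + 1) = (- 4) ^ (2 * k + 1)] (mod int p)"
    by (rule cong_pow[OF f])
  moreover have "(- 4 :: int) ^ (2 * k + 1) = - (2 ^ (2 * (2 * k + 1)))"
    by (simp add: power_mult)
  moreover have "[- (2 ^ (2 * (2 * k + 1))) = - (1 :: int)] (mod int p)"
    unfolding cong_minus_minus_iff using ndvd by (intro res[OF two]) (simp add: cong_iff_dvd_diff)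
  ultimately have "[1 = - (1 :: int)] (mod int p)" by (metis cong_sym cong_trans)
  then show False using ndvd by (simp add: cong_iff_dvd_diff)
qed

text \<open>The product of the two congruences makes a power of 2 a square modulo \<open>p\<close>;
  an odd exponent would make 2 itself a residue.\<close>

lemma even_exponent_sum:
  fixes p :: nat and a :: int
  assumes "prime p" "p mod 8 = 5"
    and "[2 ^ x\<^sub>1 = a ^ z\<^sub>1] (mod int p)" "[2 ^ x\<^sub>2 = a ^ z\<^sub>2] (mod int p)" "even (z\<^sub>1 + z\<^sub>2)"
  shows "even (x\<^sub>1 + x\<^sub>2)"
proof (rule ccontr)
  assume "odd (x\<^sub>1 + x\<^sub>2)"
  then obtain k where k: "x\<^sub>1 + x\<^sub>2 = 2 * k + 1" by (meson oddE)
  obtain l where l: "z\<^sub>1 + z\<^sub>2 = 2 * l" using assms(5) by blast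
  have "[2 ^ x\<^sub>1 * 2 ^ x\<^sub>2 = a ^ z\<^sub>1 * a ^ z\<^sub>2] (mod int p)" by (intro cong_mult assms)
  then have c: "[2 * (2 ^ k)\<^sup>2 = (a ^ l)\<^sup>2] (mod int p)"
    by (simp add: k l mult.commute flip: power_add power_mult)
  have "p \<noteq> 2" using assms(2) by auto
  then have "coprime (2 ^ k) (int p)"
    using assms(1) prime_odd_nat[of p] prime_ge_2_nat[of p] by (simp add: coprime_left_2_iff_odd)
  then obtain s where s: "[2 ^ k * s = 1] (mod int p)" using cong_solve_coprime_int by blast
  have "(a ^ l * s)\<^sup>2 = (a ^ l)\<^sup>2 * s\<^sup>2" by (simp add: power_mult_distrib)
  also have "[\<dots> = 2 * (2 ^ k)\<^sup>2 * s\<^sup>2] (mod int p)" by (intro cong_mult cong_sym[OF c] cong_refl)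
  also have "2 * (2 ^ k)\<^sup>2 * s\<^sup>2 = 2 * (2 ^ k * s)\<^sup>2" by (simp add: power_mult_distrib)
  also have "[\<dots> = 2 * 1\<^sup>2] (mod int p)" by (intro cong_mult cong_pow s cong_refl)
  finally have "QuadRes (int p) 2" unfolding QuadRes_def by auto
  then show False using two_nonresidue assms(1,2) by blast
qed

text \<open>Thue's pigeonhole argument.\<close>

lemma prime_two_squares:
  fixes q :: nat and P :: int
  assumes "prime q" "odd q" "int q dvd P\<^sup>2 + 4"
  obtains a b :: int where "4 * a\<^sup>2 + b\<^sup>2 = int q"
proof -
  define K where "K = floor_sqrt q"
  have K: "K\<^sup>2 \<le> q" "q < (Suc K)\<^sup>2" unfolding K_def by (rule floor_sqrt_power2_le, rule Suc_floor_sqrt_power2_gt)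
  have "K\<^sup>2 \<noteq> q" using assms(1) by (auto simp: prime_power_iff)
  \<comment> \<open>Modulo \<open>q\<close> the square of P/2 is -1, so a collision of
    \<open>f\<close> yields x^2 + y^2 = 0 mod \<open>q\<close> for the differences.\<close>
  define f where "f = (\<lambda>(u, v). (P * int u - 2 * int v) mod int q)"
  have "f ` ({..K} \<times> {..K}) \<subseteq> {0..<int q}"
    using assms(1) prime_gt_0_nat by (auto simp: f_def)
  then have "card (f ` ({..K} \<times> {..K})) \<le> card {0..<int q}" by (intro card_mono) auto
  also have "\<dots> < card ({..K} \<times> {..K})" using K(2) by (simp add: power2_eq_square card_cartesian_product)
  finally have "\<not> inj_on f ({..K} \<times> {..K})" using card_image by fastforce
  then obtain u v u' v' where uv: "u \<le> K" "v \<le> K" "u' \<le> K" "v' \<le> K" "(u, v) \<noteq> (u', v')" "f (u, v) = f (u', v')"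
    unfolding inj_on_def by auto
  define x y where "x = int u - int u'" and "y = int v - int v'"
  have "int q dvd (P * int u - 2 * int v) - (P * int u' - 2 * int v')"
    using uv(6) by (simp add: f_def mod_eq_dvd_iff)
  also have "\<dots> = P * x - 2 * y" by (simp add: x_def y_def algebra_simps)
  finally have "int q dvd (P\<^sup>2 + 4) * x\<^sup>2 - (P * x - 2 * y) * (P * x + 2 * y)"
    using assms(3) by (metis dvd_diff dvd_mult2)
  also have "\<dots> = 4 * (x\<^sup>2 + y\<^sup>2)" by (simp add: power2_eq_square algebra_simps)
  finally have "int q dvd 4 * (x\<^sup>2 + y\<^sup>2)" .
  moreover have "coprime (int q) 4"
  proof -
    have "coprime (int q) (2 ^ 2)"
      unfolding coprime_power_right_iff using assms(2) by (simp add: coprime_right_2_iff_odd)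
    then show ?thesis by simp
  qed
  ultimately have dvd: "int q dvd x\<^sup>2 + y\<^sup>2" using coprime_dvd_mult_right_iff by blast
  have "\<bar>x\<bar> \<le> int K" "\<bar>y\<bar> \<le> int K" using uv by (simp_all add: x_def y_def)
  then have "x\<^sup>2 \<le> (int K)\<^sup>2" "y\<^sup>2 \<le> (int K)\<^sup>2" by (simp_all add: abs_le_square_iff[symmetric])
  moreover have "(int K)\<^sup>2 < int q" using K(1) \<open>K\<^sup>2 \<noteq> q\<close>
    by (metis le_neq_implies_less of_nat_less_iff of_nat_power)
  ultimately have lt: "x\<^sup>2 + y\<^sup>2 < 2 * int q" by linarith
  have "x \<noteq> 0 \<or> y \<noteq> 0" using uv(5) by (auto simp: x_def y_def)
  then have pos: "0 < x\<^sup>2 + y\<^sup>2" by (simp add: sum_power2_gt_zero_iff)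
  obtain j where j: "x\<^sup>2 + y\<^sup>2 = int q * j" using dvd by blast
  have "0 < int q" using assms(1) prime_gt_0_nat by simp
  then have "0 < j" "j < 2"
    using pos lt unfolding j by (simp_all add: zero_less_mult_iff mult.commute)
  then have q: "x\<^sup>2 + y\<^sup>2 = int q" using j by simp
  then have "odd (x\<^sup>2 + y\<^sup>2)" using assms(2) by simp
  then consider "even x" | "even y" by fastforce
  then show ?thesis
  proof cases
    case 1
    then obtain a where "x = 2 * a" by blast
    then show ?thesis using q that[of a y] by (simp add: power_mult_distrib)
  next
    case 2
    then obtain a where "y = 2 * a" by blast
    then show ?thesis using q that[of a x] by (simp add: power_mult_distrib add.commute)
  qed
qed

subsection \<open>Solutions with odd exponents\<close>

text \<open>A solution is an odd power of the generator, so C r^2 = 2^x with \<open>r\<close> the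
  real part. Since \<open>C\<close> is even and \<open>D\<close> odd, \<open>r\<close> is odd and
  hence a unit: the generator already carries the full power of 2.\<close>

lemma power_solution_odd_power:
  fixes p :: nat and q :: int
  assumes p: "prime p" "3 < p"
    and q: "prime q" "\<not> q dvd 2" "\<not> q dvd A" "\<not> q dvd B" and AB: "0 < A" "0 < B" "1 < A * B"
    and \<gamma>: "A * a\<^sup>2 + B * b\<^sup>2 = q ^ g" "odd g" "\<not> q dvd a"
    and min: "\<forall>h c d. odd h \<longrightarrow> A * c\<^sup>2 + B * d\<^sup>2 = q ^ h \<longrightarrow> g \<le> h"
    and sol: "A * c\<^sup>2 = 2 ^ x" "B * d\<^sup>2 = int p ^ y" "2 ^ x + int p ^ y = q ^ z" "odd z"
  obtains n where "A * a\<^sup>2 = 2 ^ x" "(re_part (A * a\<^sup>2) (B * b\<^sup>2) n)\<^sup>2 = 1"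
    "B * b\<^sup>2 * (im_part (A * a\<^sup>2) (B * b\<^sup>2) n)\<^sup>2 = int p ^ y"
proof -
  have "\<not> q dvd c"
  proof
    assume "q dvd c"
    then have "q dvd A * c\<^sup>2" by (simp add: power2_eq_square)
    then have "q dvd 2" unfolding sol(1) using q(1) prime_dvd_power by blast
    then show False using q(2) by simp
  qed
  then obtain n where n: "\<bar>c\<bar> = \<bar>a * re_part (A * a\<^sup>2) (B * b\<^sup>2) n\<bar>" "\<bar>d\<bar> = \<bar>b * im_part (A * a\<^sup>2) (B * b\<^sup>2) n\<bar>"
    using binary_form_odd_power[OF q AB \<gamma> min _ sol(4), of c d] sol(1-3) \<open>\<not> q dvd c\<close> by auto
  define C D where "C = A * a\<^sup>2" and "D = B * b\<^sup>2"
  define r s where "r = re_part C D n" and "s = im_part C D n"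
  have "c\<^sup>2 = (a * r)\<^sup>2" "d\<^sup>2 = (b * s)\<^sup>2"
    using n unfolding r_def s_def C_def D_def by (metis power2_abs)+
  then have Cr: "C * r\<^sup>2 = 2 ^ x" and Ds: "D * s\<^sup>2 = int p ^ y"
    using sol(1,2) by (simp_all add: C_def D_def power_mult_distrib mult.assoc)
  have "odd p" using p prime_odd_nat[of p] by simp
  then have "odd (D * s\<^sup>2)" unfolding Ds by simp
  then have D: "odd D" by simp
  have "odd q"
  proof
    assume "even q"
    then have "2 = q" using q(1) primes_dvd_imp_eq[of 2 q] by simp
    then show False using q(2) by simp
  qed
  then have "odd (q ^ g)" by simp
  then have "even C" using D \<gamma>(1) by (metis C_def D_def even_add)
  then have "odd r" unfolding r_def using D by (rule odd_re_part)
  then have "coprime (r\<^sup>2) (2 ^ x)" by (simp add: coprime_right_2_iff_odd)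
  moreover have "r\<^sup>2 dvd 2 ^ x" using Cr by (metis dvd_triv_right)
  ultimately have "is_unit (r\<^sup>2)" by (meson coprime_common_divisor dvd_refl)
  then have r: "r\<^sup>2 = 1" by simp
  show ?thesis
    using that[of n] Cr Ds r unfolding r_def s_def C_def D_def by simp
qed

lemma odd_prime_int_not_dvd_2:
  fixes q :: nat
  assumes "prime q" "odd q"
  shows "\<not> int q dvd 2"
proof
  assume "int q dvd 2"
  then have "q dvd 2" by (metis of_nat_dvd_iff of_nat_numeral)
  then show False using assms primes_dvd_imp_eq two_is_prime_nat by blast
qed

text \<open>Equal parity of the \<open>x\<close> exponents puts both solutions into the same form A
  c^2 + p d^2 with \<open>A\<close> equal to 1 or 2. Each is then the first power of the same
  generator.\<close>

lemma odd_solution_unique: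
  fixes p q :: nat
  assumes p: "prime p" "3 < p" and q: "prime q" "odd q" "p \<noteq> q"
    and e1: "2 ^ x\<^sub>1 + p ^ y\<^sub>1 = q ^ z\<^sub>1" "odd y\<^sub>1" "odd z\<^sub>1"
    and e2: "2 ^ x\<^sub>2 + p ^ y\<^sub>2 = q ^ z\<^sub>2" "odd y\<^sub>2" "odd z\<^sub>2"
    and par: "even (x\<^sub>1 + x\<^sub>2)"
  shows "(x\<^sub>1, y\<^sub>1, z\<^sub>1) = (x\<^sub>2, y\<^sub>2, z\<^sub>2)"
proof -
  define A :: int where "A = 2 ^ (x\<^sub>1 mod 2)"
  have A: "A = 1 \<or> A = 2" by (cases "even x\<^sub>1") (simp_all add: A_def odd_iff_mod_2_eq_one)
  have qi: "prime (int q)" using q(1) by simp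
  have q2: "\<not> int q dvd 2" using q odd_prime_int_not_dvd_2 by blast
  have qA: "\<not> int q dvd A" using A q2 qi by auto
  have qp: "\<not> int q dvd int p" using p q primes_dvd_imp_eq by auto
  have AB: "0 < A" "0 < int p" "1 < A * int p" using A p by auto
  have rep: "A * (2 ^ (x div 2))\<^sup>2 = 2 ^ x" "int p * (int p ^ (y div 2))\<^sup>2 = int p ^ y"
    "2 ^ x + int p ^ y = int q ^ z"
    if "2 ^ x + p ^ y = q ^ z" "odd y" "even (x\<^sub>1 + x)" for x y z
  proof -
    have "x\<^sub>1 mod 2 = x mod 2" using that(3) by presburger
    moreover have "A * (2 ^ (x div 2))\<^sup>2 = 2 ^ (x\<^sub>1 mod 2 + 2 * (x div 2))"
      by (simp add: A_def power_add power_even_eq)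
    ultimately show "A * (2 ^ (x div 2))\<^sup>2 = 2 ^ x" by (simp add: mod_mult_div_eq)
    have "int p * (int p ^ (y div 2))\<^sup>2 = int p ^ (1 + 2 * (y div 2))"
      by (simp add: power_add power_even_eq)
    then show "int p * (int p ^ (y div 2))\<^sup>2 = int p ^ y" using that(2) by simp
    show "2 ^ x + int p ^ y = int q ^ z"
      using that(1) by (metis of_nat_add of_nat_numeral of_nat_power)
  qed
  have par': "even (x\<^sub>1 + x\<^sub>1)" by simp
  note rep1 = rep[OF e1(1,2) par'] and rep2 = rep[OF e2(1,2) par]
  have "A * (2 ^ (x\<^sub>1 div 2))\<^sup>2 + int p * (int p ^ (y\<^sub>1 div 2))\<^sup>2 = int q ^ z\<^sub>1"
    using rep1 by simp
  then obtain a b g where \<gamma>: "A * a\<^sup>2 + int p * b\<^sup>2 = int q ^ g" "odd g" "\<not> int q dvd a"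
    and min: "\<forall>h c d. odd h \<longrightarrow> A * c\<^sup>2 + int p * d\<^sup>2 = int q ^ h \<longrightarrow> g \<le> h"
    using binary_form_generator[OF qi qA qp _ e1(3)] by metis
  have gen: "A * a\<^sup>2 = 2 ^ x \<and> int p * b\<^sup>2 = int p ^ y"
    if sol: "A * c\<^sup>2 = 2 ^ x" "int p * d\<^sup>2 = int p ^ y" "2 ^ x + int p ^ y = int q ^ z" "odd z" for c d x y z
  proof -
    obtain n where n: "A * a\<^sup>2 = 2 ^ x" "(re_part (A * a\<^sup>2) (int p * b\<^sup>2) n)\<^sup>2 = 1"
      "int p * b\<^sup>2 * (im_part (A * a\<^sup>2) (int p * b\<^sup>2) n)\<^sup>2 = int p ^ y"
      using power_solution_odd_power[OF p qi q2 qA qp AB \<gamma> min sol] by blast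
    have "0 < (2::int) ^ x" "0 < int p ^ y" using p by simp_all
    then have "0 < A * a\<^sup>2" "0 < int p * b\<^sup>2"
      using n(1) n(3) AB by (simp, smt (verit) mult_nonneg_nonneg zero_le_power2 mult_eq_0_iff)
    moreover have "int p dvd int p * b\<^sup>2" by simp
    moreover have "\<not> int p dvd A * a\<^sup>2"
    proof
      assume "int p dvd A * a\<^sup>2"
      then have "int p dvd 2" unfolding n(1) using p(1) prime_dvd_power[of "int p" 2 x] by simp
      then show False using p(2) zdvd_imp_le[of "int p" 2] by simp
    qed
    moreover have "im_part (A * a\<^sup>2) (int p * b\<^sup>2) n dvd int p ^ y"
      unfolding n(3)[symmetric] by (simp add: power2_eq_square)
    ultimately have "n = 0" using parts_prime_power_unit[OF p] n(2) by blast
    then show ?thesis using n by simp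
  qed
  have "A * a\<^sup>2 = 2 ^ x\<^sub>1 \<and> int p * b\<^sup>2 = int p ^ y\<^sub>1" "A * a\<^sup>2 = 2 ^ x\<^sub>2 \<and> int p * b\<^sup>2 = int p ^ y\<^sub>2"
    using gen[OF rep1 e1(3)] gen[OF rep2 e2(3)] by simp_all
  then have x: "(2::int) ^ x\<^sub>1 = 2 ^ x\<^sub>2" and y: "int p ^ y\<^sub>1 = int p ^ y\<^sub>2" by simp_all
  have "x\<^sub>1 = x\<^sub>2" using x by simp
  moreover have "y\<^sub>1 = y\<^sub>2" using y p by (simp add: power_inject_exp)
  moreover have "z\<^sub>1 = z\<^sub>2"
  proof -
    have "q ^ z\<^sub>1 = q ^ z\<^sub>2" using e1(1) e2(1) calculation by simp
    then show ?thesis using prime_gt_1_nat[OF q(1)] by (simp add: power_inject_exp)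
  qed
  ultimately show ?thesis by simp
qed

subsection \<open>Solutions with \<open>x = 2\<close>\<close>

text \<open>The number -7 + 24i is (2 + i)^4. For its \<open>k\<close>-th power minus 1 both
  coordinates have the same 2-adic valuation \<open>e\<close>. Doubling \<open>k\<close> raises
  \<open>e\<close> by one; one more factor after an even power returns it to 3, which is where
  \<open>4 \<le> e\<close> for even \<open>k\<close> enters.\<close>

lemma complex_power_2adic:
  assumes "0 < k"
  shows "\<exists>e u v. odd u \<and> odd v \<and> 3 \<le> e \<and> (even k \<longrightarrow> 4 \<le> e) \<and>
    Complex (- 7) 24 ^ k = Complex (of_int (1 + 2 ^ e * u)) (of_int (2 ^ e * v))"
  using assms
proof (induction k rule: less_induct)
  case (less k)
  show ?case
  proof (cases "even k")
    case True
    then obtain j where j: "k = 2 * j" by blast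
    then obtain e u v where IH: "odd u" "odd v" "3 \<le> e"
      "Complex (- 7) 24 ^ j = Complex (of_int (1 + 2 ^ e * u)) (of_int (2 ^ e * v))"
      using less.IH[of j] less.prems by auto
    obtain d where d: "e = Suc d" using IH(3) by (cases e) auto
    define u' v' where "u' = u + 2 ^ d * (u\<^sup>2 - v\<^sup>2)" and "v' = v * (1 + 2 ^ e * u)"
    have "(1 + 2 ^ e * u)\<^sup>2 - (2 ^ e * v)\<^sup>2 = 1 + 2 ^ Suc e * u'"
      "2 * (1 + 2 ^ e * u) * (2 ^ e * v) = 2 ^ Suc e * v'"
      unfolding u'_def v'_def d by (simp_all add: power2_eq_square algebra_simps)
    moreover have "Complex (- 7) 24 ^ k = (Complex (- 7) 24 ^ j)\<^sup>2"
      by (simp add: j power_even_eq)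
    moreover have "(Complex (of_int x) (of_int y))\<^sup>2 = Complex (of_int (x\<^sup>2 - y\<^sup>2)) (of_int (2 * x * y))" for x y
      by (simp add: power2_eq_square complex_eq_iff)
    ultimately have "Complex (- 7) 24 ^ k = Complex (of_int (1 + 2 ^ Suc e * u')) (of_int (2 ^ Suc e * v'))"
      unfolding IH(4) by metis
    moreover have "odd u'" "odd v'" using IH(1-3) by (auto simp: u'_def v'_def)
    ultimately show ?thesis using IH(3) by (intro exI[of _ "Suc e"] exI[of _ u'] exI[of _ v']) simp
  next
    case False
    show ?thesis
    proof (cases "k = 1")
      case True
      then show ?thesis by (intro exI[of _ 3] exI[of _ "- 1"] exI[of _ 3]) simp
    next
      case k1: False
      define j where "j = k - 1"
      have j: "k = Suc j" "even j" "0 < j" using False k1 less.prems by (auto simp: j_def)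
      then obtain e u v where IH: "odd u" "odd v" "4 \<le> e"
        "Complex (- 7) 24 ^ j = Complex (of_int (1 + 2 ^ e * u)) (of_int (2 ^ e * v))"
        using less.IH[of j] by auto
      obtain d where d: "e = d + 4" using IH(3) by (metis le_add_diff_inverse2)
      define u' v' where "u' = - 1 - 14 * 2 ^ d * u - 3 * 2 ^ e * v" and "v' = 3 + 3 * 2 ^ e * u - 14 * 2 ^ d * v"
      have "- 7 * (1 + 2 ^ e * u) - 24 * (2 ^ e * v) = 1 + 2 ^ 3 * u'"
        "24 * (1 + 2 ^ e * u) - 7 * (2 ^ e * v) = 2 ^ 3 * v'"
        unfolding u'_def v'_def d by (simp_all add: power_add algebra_simps)
      moreover have "Complex (- 7) 24 * Complex (of_int x) (of_int y)
        = Complex (of_int (- 7 * x - 24 * y)) (of_int (24 * x - 7 * y))" for x y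
        by (simp add: complex_eq_iff)
      ultimately have "Complex (- 7) 24 ^ k = Complex (of_int (1 + 2 ^ 3 * u')) (of_int (2 ^ 3 * v'))"
        unfolding j(1) power_Suc IH(4) by metis
      moreover have "odd u'" "odd v'" using IH(3) by (auto simp: u'_def v'_def)
      ultimately show ?thesis using False by (intro exI[of _ 3] exI[of _ u'] exI[of _ v']) simp
    qed
  qed
qed

text \<open>The two indices correspond to \<open>4 + 1\<^sup>2 = 5\<close> and \<open>4 + 11\<^sup>2 = 5\<^sup>3\<close>.\<close>

lemma re_part_4_1_unit:
  assumes "(re_part 4 1 n)\<^sup>2 = 1"
  shows "n \<le> 1"
proof (rule ccontr)
  assume "\<not> n \<le> 1"
  \<comment> \<open>Fourth powers are split off; what remains is 2 + i or (2 + i)^3 = 2 +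
    11i.\<close>
  define k c where "k = n div 2" and "c = (if even n then 1 else 11 :: int)"
  have k: "0 < k" using \<open>\<not> n \<le> 1\<close> by (simp add: k_def)
  then obtain e u v where euv: "odd u" "odd v" "3 \<le> e"
    "Complex (- 7) 24 ^ k = Complex (of_int (1 + 2 ^ e * u)) (of_int (2 ^ e * v))"
    using complex_power_2adic by blast
  have "Complex 2 1 ^ (2 * n + 1) = Complex (2 * of_int (re_part 4 1 n)) (1 * of_int (im_part 4 1 n))"
    by (rule complex_odd_power) simp_all
  moreover have "Complex 2 1 ^ (2 * n + 1) = Complex 2 (of_int c) * Complex (- 7) 24 ^ k"
  proof -
    have w: "Complex 2 1 ^ 4 = Complex (- 7) 24"
      by (simp add: complex_eq_iff power4_eq_xxxx)
    have c: "Complex 2 1 ^ (2 * (n mod 2) + 1) = Complex 2 (of_int c)"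
      by (cases "even n") (simp_all add: c_def odd_iff_mod_2_eq_one complex_eq_iff power3_eq_cube)
    have "2 * n + 1 = 2 * (n mod 2) + 1 + 4 * k" unfolding k_def by presburger
    then have "Complex 2 1 ^ (2 * n + 1) = Complex 2 1 ^ (2 * (n mod 2) + 1) * (Complex 2 1 ^ 4) ^ k"
      by (metis power_add power_mult)
    then show ?thesis unfolding w c .
  qed
  ultimately have "2 * real_of_int (re_part 4 1 n) = of_int (2 * (1 + 2 ^ e * u) - c * (2 ^ e * v))"
    unfolding euv(4) by (simp add: complex_eq_iff)
  then have "2 * re_part 4 1 n = 2 * (1 + 2 ^ e * u) - c * (2 ^ e * v)"
    by (metis of_int_eq_iff of_int_mult of_int_numeral)
  then have eq: "2 * re_part 4 1 n = 2 + 2 ^ e * (2 * u - c * v)" by (simp add: algebra_simps)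
  \<comment> \<open>A real part of 1 or -1 forces \<open>2 ^ e\<close> times this odd number to be 0
    or -4, impossible for \<open>3 \<le> e\<close>.\<close>
  have "odd (2 * u - c * v)" using euv(2) by (simp add: c_def)
  moreover have "re_part 4 1 n = 1 \<or> re_part 4 1 n = - 1" using assms by (simp add: power2_eq_1_iff)
  then have "2 ^ e * (2 * u - c * v) = 0 \<or> 2 ^ e * (2 * u - c * v) = - 4" using eq by auto
  moreover have "\<not> (8 :: int) dvd - 4" by simp
  moreover have "(8 :: int) dvd 2 ^ e" using le_imp_power_dvd[OF euv(3), of "2 :: int"] by simp
  ultimately show False by (metis dvd_mult2 even_zero mult_eq_0_iff power_eq_0_iff zero_neq_numeral)
qed

text \<open>Since \<open>q\<close> divides a sum of two squares, 4 c^2 + d^2 represents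
  \<open>q\<close> itself and the generator has exponent 1. If \<open>p\<close> divides
  \<open>D\<close>, the solution is this generator. Otherwise D = 1 and q = 5, where only
  \<open>p ^ y\<close> = 11^2 is left to exclude.\<close>

lemma four_plus_even_prime_power:
  fixes p q :: nat
  assumes p: "prime p" "p mod 8 = 5" and q: "prime q" "odd q"
    and eq: "4 + p ^ y = q ^ z" "even y" "0 < y" "odd z"
  shows "z = 1"
proof -
  obtain m where m: "y = 2 * m" using eq(2) by blast
  have p3: "3 < p" using p(2) mod_less_eq_dividend[of p 8] by linarith
  have qi: "prime (int q)" using q(1) by simp
  have q2: "\<not> int q dvd 2" using q odd_prime_int_not_dvd_2 by blast
  have q4: "\<not> int q dvd 4"
    using q2 qi prime_dvd_power[of "int q" 2 2] by auto
  have q1: "\<not> int q dvd 1" using qi not_prime_unit by blast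
  have eqi: "4 + int p ^ y = int q ^ z" using eq(1) by (metis of_nat_add of_nat_numeral of_nat_power)
  then have sq: "(int p ^ m)\<^sup>2 + 4 = int q ^ z" by (simp add: m power_even_eq add.commute)
  then have "int q dvd (int p ^ m)\<^sup>2 + 4" using eq(4) odd_pos by simp
  then obtain a' b' where ab': "4 * a'\<^sup>2 + b'\<^sup>2 = int q" using prime_two_squares[OF q] by blast
  have sol: "4 * 1\<^sup>2 = (2 :: int) ^ 2" "1 * (int p ^ m)\<^sup>2 = int p ^ y" "2 ^ 2 + int p ^ y = int q ^ z"
    using eqi by (simp_all add: m power_even_eq)
  have "4 * 1\<^sup>2 + 1 * (int p ^ m)\<^sup>2 = int q ^ z" using sq by simp
  then obtain a b g where \<gamma>: "4 * a\<^sup>2 + 1 * b\<^sup>2 = int q ^ g" "odd g" "\<not> int q dvd a"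
    and min: "\<forall>h c d. odd h \<longrightarrow> 4 * c\<^sup>2 + 1 * d\<^sup>2 = int q ^ h \<longrightarrow> g \<le> h"
    using binary_form_generator[OF qi q4 q1 _ eq(4)] by metis
  have "g \<le> 1" using min[rule_format, of 1 a' b'] ab' by simp
  then have g: "g = 1" using \<gamma>(2) by (cases g) auto
  obtain n where n: "4 * a\<^sup>2 = 2 ^ 2" "(re_part (4 * a\<^sup>2) (1 * b\<^sup>2) n)\<^sup>2 = 1"
    "1 * b\<^sup>2 * (im_part (4 * a\<^sup>2) (1 * b\<^sup>2) n)\<^sup>2 = int p ^ y"
    by (rule power_solution_odd_power[OF p(1) p3 qi q2 q4 q1 _ _ _ \<gamma> min sol eq(4)]) simp_all
  have C: "4 * a\<^sup>2 = 4" using n(1) by simp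
  define D where "D = b\<^sup>2"
  have n: "(re_part 4 D n)\<^sup>2 = 1" "D * (im_part 4 D n)\<^sup>2 = int p ^ y" and D: "4 + D = int q"
    using n(2,3) \<gamma>(1) unfolding C g D_def by simp_all
  have pi: "prime (int p)" using p by simp
  have "0 < int p ^ y" using p3 by simp
  then have "D \<noteq> 0" using n(2) by auto
  then have "0 < D" by (simp add: D_def)
  show ?thesis
  proof (cases "int p dvd D")
    case True
    have "\<not> int p dvd 4" using p3 zdvd_imp_le[of "int p" 4] p by auto
    moreover have "im_part 4 D n dvd int p ^ y" unfolding n(2)[symmetric] by (simp add: power2_eq_square)
    ultimately have "n = 0"
      using parts_prime_power_unit[OF p(1) p3 _ \<open>0 < D\<close> True _ n(1), of y] by simp
    then have "int q ^ z = int q ^ 1" using n(2) D eqi by simp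
    moreover have "1 < int q" using q(1) prime_gt_1_nat by simp
    ultimately show ?thesis using power_inject_exp by blast
  next
    case False
    then have "coprime D (int p ^ y)"
      using prime_imp_coprime[OF pi] coprime_commute coprime_power_left_iff by metis
    moreover have "D dvd int p ^ y" using n(2) by (metis dvd_triv_left)
    ultimately have "is_unit D" by (meson coprime_common_divisor dvd_refl)
    then have D1: "D = 1" using \<open>0 < D\<close> by simp
    then have "n \<le> 1" using re_part_4_1_unit n(1) by simp
    moreover have "im_part 4 1 (Suc 0) = 11" by simp
    ultimately have "int p ^ y = 1 \<or> int p ^ y = 11\<^sup>2"
      using n(2) D1 by (cases n) auto
    moreover have "1 < int p ^ y" using p3 eq(3) by (intro one_less_power) simp_all
    ultimately have "int p ^ y = 11\<^sup>2" by linarith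
    then have "int p dvd 11\<^sup>2" using eq(3) by (metis dvd_power)
    then have "int p dvd 11" using pi prime_dvd_power by blast
    then have "p dvd 11" by (metis of_nat_dvd_iff of_nat_numeral)
    then have "p \<le> 11" by (simp add: dvd_imp_le)
    then have "p = 5" using p(2) by presburger
    then show ?thesis using \<open>p dvd 11\<close> by simp
  qed
qed

subsection \<open>Solutions of both kinds\<close>

lemma square_mod_4_int: "(s :: int)\<^sup>2 mod 4 \<noteq> 3"
proof (cases "even s")
  case True
  then obtain t where "s = 2 * t" by blast
  then show ?thesis by (simp add: power_mult_distrib)
next
  case False
  then obtain t where "s = 2 * t + 1" by (meson oddE)
  then have "s\<^sup>2 = 4 * (t\<^sup>2 + t) + 1" by (simp add: power2_eq_square algebra_simps)
  then show ?thesis by (simp only: mod_mult_self4) simp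
qed

lemma coprime_factor_square_int:
  fixes t T S :: int
  assumes "t * T = S\<^sup>2" "coprime t T" "0 < t" "0 < T"
  shows "\<exists>s. T = s\<^sup>2"
proof -
  have "nat T * nat t = (nat \<bar>S\<bar>)\<^sup>2"
    using assms by (metis mult.commute nat_mult_distrib nat_power_eq abs_ge_zero power2_abs less_imp_le)
  moreover have "coprime (nat T) (nat t)"
    using assms(2-4) by (metis coprime_commute coprime_int_iff nat_0_le less_imp_le)
  ultimately have "is_nth_power 2 (nat T)"
    using assms(3,4) is_nth_power_mult_coprime_natD(1)[of "nat T" "nat t" 2]
    by (metis is_nth_power_def zero_less_nat_eq)
  then obtain s where "nat T = s\<^sup>2" by (auto elim: is_nth_powerE)
  then have "T = (int s)\<^sup>2" using assms(4) by (metis int_nat_eq of_nat_power less_imp_le)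
  then show ?thesis by blast
qed

text \<open>In the quadratic field of \<open>q\<close>, let \<open>N\<close> be half the trace of
  \<open>(X + Q \<surd>q) (P - 2 + \<surd>q)\<close>; its norm is \<open>(2 Y W)\<^sup>2\<close>. Then \<open>N + 2 Y W\<close> and
  \<open>N - 2 Y W\<close> are coprime with product \<open>q\<close> times a square, so one of them is a square,
  yet both are 3 modulo 4. The hypothesis on \<open>X - 2 * Q\<close> serves coprimality and can be
  reached by changing the sign of \<open>X\<close>.\<close>

lemma no_norm_equation_solution:
  fixes p q P Q W X Y :: int
  assumes p: "prime p" "odd p" and q: "prime q" "q = P\<^sup>2 + 4" and P: "0 < P" "p dvd P" "W\<^sup>2 = P * p"
    and eq: "q * Q\<^sup>2 = X\<^sup>2 + p * Y\<^sup>2" "0 < Q" "4 dvd X" "(q * Q) mod 4 = 1"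
    and pow: "Y dvd p ^ i" "W dvd p ^ j" and ndvd: "\<not> p dvd X - 2 * Q"
  shows False
proof -
  define N T\<^sub>1 T\<^sub>2 S where "N = X * (P - 2) + q * Q" and "T\<^sub>1 = N + 2 * (Y * W)" and "T\<^sub>2 = N - 2 * (Y * W)"
    and "S = X + Q * (P - 2)"
  have YW: "odd Y" "odd W" using pow p(2) by (metis dvd_trans even_power)+
  obtain v where v: "q * Q = 4 * v + 1" using eq(4) by (metis mult_div_mod_eq)
  then have oqQ: "odd (q * Q)" by simp
  then have "odd P" using q(2) by simp
  have "even X" using eq(3) by (metis dvd_trans even_numeral)
  have mod4: "T\<^sub>1 mod 4 = 3" "T\<^sub>2 mod 4 = 3"
  proof -
    obtain x where x: "X = 4 * x" using eq(3) by blast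
    obtain w where w: "Y * W = 2 * w + 1" using YW by (meson oddE even_mult_iff)
    have "T\<^sub>1 = 4 * (x * (P - 2) + v + w) + 3" "T\<^sub>2 = 4 * (x * (P - 2) + v - w - 1) + 3"
      unfolding T\<^sub>1_def T\<^sub>2_def N_def x w v by (simp_all add: algebra_simps)
    then show "T\<^sub>1 mod 4 = 3" "T\<^sub>2 mod 4 = 3" by (simp_all only: mod_mult_self4) simp_all
  qed
  \<comment> \<open>Here \<open>S\<close> is the coefficient of \<surd>q in the product, so N^2 - q
    S^2 is its norm.\<close>
  have prod: "T\<^sub>1 * T\<^sub>2 = q * S\<^sup>2"
  proof -
    have "T\<^sub>1 * T\<^sub>2 = N\<^sup>2 - 4 * (p * Y\<^sup>2) * P"
    proof -
      have "T\<^sub>1 * T\<^sub>2 = N\<^sup>2 - 4 * Y\<^sup>2 * W\<^sup>2"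
        by (simp add: T\<^sub>1_def T\<^sub>2_def power2_eq_square algebra_simps)
      then show ?thesis unfolding P(3) by (simp add: algebra_simps)
    qed
    also have "p * Y\<^sup>2 = q * Q\<^sup>2 - X\<^sup>2" using eq(1) by simp
    also have "N\<^sup>2 - 4 * (q * Q\<^sup>2 - X\<^sup>2) * P = q * S\<^sup>2"
      unfolding N_def S_def q(2) by (simp add: power2_eq_square algebra_simps)
    finally show ?thesis .
  qed
  have "odd S" using \<open>even X\<close> \<open>odd P\<close> oqQ by (simp add: S_def)
  then have "S \<noteq> 0" by auto
  have q0: "0 < q" using q(1) prime_gt_0_int by blast
  then have pos: "0 < T\<^sub>1 * T\<^sub>2" unfolding prod using \<open>S \<noteq> 0\<close> by simp
  \<comment> \<open>Both X^2 \<le> q Q^2 and (P - 2)^2 < q hold, so X (P - 2) cannot outweigh q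
    Q.\<close>
  have "0 < N"
  proof (rule ccontr)
    assume "\<not> 0 < N"
    then have "q * Q \<le> - (X * (P - 2))" by (simp add: N_def)
    then have "(q * Q)\<^sup>2 \<le> (- (X * (P - 2)))\<^sup>2"
      using q0 eq(2) by (intro power_mono) simp_all
    also have "\<dots> = X\<^sup>2 * (P - 2)\<^sup>2" by (simp add: power_mult_distrib)
    also have "\<dots> \<le> (q * Q\<^sup>2) * (P - 2)\<^sup>2"
      unfolding eq(1) using p(1) prime_ge_0_int[of p] by (intro mult_right_mono) simp_all
    also have "\<dots> < (q * Q\<^sup>2) * q"
    proof (rule mult_strict_left_mono)
      show "(P - 2)\<^sup>2 < q" using P(1) by (simp add: q(2) power2_eq_square algebra_simps)
      show "0 < q * Q\<^sup>2" using q0 eq(2) by simp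
    qed
    also have "\<dots> = (q * Q)\<^sup>2" by (simp add: power2_eq_square)
    finally show False by simp
  qed
  then have "0 < T\<^sub>1 + T\<^sub>2" by (simp add: T\<^sub>1_def T\<^sub>2_def)
  then have T: "0 < T\<^sub>1" "0 < T\<^sub>2" using pos by (auto simp: zero_less_mult_iff)
  have cop: "coprime T\<^sub>1 T\<^sub>2"
  proof (rule ccontr)
    assume "\<not> coprime T\<^sub>1 T\<^sub>2"
    then obtain c where c: "c dvd T\<^sub>1" "c dvd T\<^sub>2" "\<not> is_unit c" by (rule not_coprimeE)
    moreover have "c \<noteq> 0" using c(1) T(1) by auto
    ultimately obtain l where "prime l" "l dvd c" using prime_divisor_exists by blast
    then have l: "prime l" "l dvd T\<^sub>1" "l dvd T\<^sub>2" using c dvd_trans by blast+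
    have "odd T\<^sub>1" using mod4(1) by presburger
    then have "odd l" using l(2) dvd_trans by blast
    have "l dvd T\<^sub>1 - T\<^sub>2" using l by (intro dvd_diff)
    also have "\<dots> = 4 * (Y * W)" by (simp add: T\<^sub>1_def T\<^sub>2_def)
    finally have "l dvd 2 ^ 2 \<or> l dvd Y \<or> l dvd W" using l(1) by (simp add: prime_dvd_mult_iff)
    then have "l dvd p"
    proof (elim disjE)
      assume "l dvd 2 ^ 2"
      then have "l dvd 2" using l(1) prime_dvd_power by blast
      then show ?thesis using l(1) \<open>odd l\<close> primes_dvd_imp_eq[of l 2] by simp
    next
      assume "l dvd Y"
      then show ?thesis using pow(1) l(1) prime_dvd_power dvd_trans by blast
    next
      assume "l dvd W"
      then show ?thesis using pow(2) l(1) prime_dvd_power dvd_trans by blast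
    qed
    then have "l = p" using l(1) p(1) primes_dvd_imp_eq by blast
    then have "p dvd T\<^sub>1" "p dvd T\<^sub>2" using l by simp_all
    then have "p dvd T\<^sub>1 + T\<^sub>2" by (rule dvd_add)
    also have "\<dots> = 2 * N" by (simp add: T\<^sub>1_def T\<^sub>2_def)
    \<comment> \<open>Modulo \<open>p\<close> the number \<open>P\<close> vanishes and
      \<open>q\<close> becomes 4, so 2N reduces to -4 (X - 2Q).\<close>
    finally have "p dvd 2 * N - P * (2 * X + 2 * P * Q)" using P(2) by (metis dvd_diff dvd_mult2)
    also have "\<dots> = 2 ^ 2 * - (X - 2 * Q)"
      unfolding N_def q(2) by (simp add: power2_eq_square algebra_simps)
    finally have "p dvd 2 ^ 2 \<or> p dvd - (X - 2 * Q)" using p(1) prime_dvd_mult_iff by blast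
    then have "p dvd 2" using ndvd p(1) prime_dvd_power dvd_minus_iff by metis
    then show False using p primes_dvd_imp_eq[of p 2] by simp
  qed
  have key: False if h: "A * B = q * S\<^sup>2" "coprime A B" "0 < A" "0 < B" "q dvd A" "B mod 4 = 3" for A B
  proof -
    obtain t where t: "A = q * t" using \<open>q dvd A\<close> by blast
    have "t * B = S\<^sup>2" using h(1) q0 unfolding t by simp
    moreover have "coprime t B" "0 < t" using h(2,3) q0 unfolding t by (simp_all add: zero_less_mult_iff)
    ultimately obtain s where "B = s\<^sup>2" using coprime_factor_square_int h(4) by blast
    then show False using h(6) square_mod_4_int by blast
  qed
  have "q dvd T\<^sub>1 * T\<^sub>2" unfolding prod by simp
  then consider "q dvd T\<^sub>1" | "q dvd T\<^sub>2" using q(1) prime_dvd_mult_iff by blast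
  then show False
  proof cases
    case 1
    then show ?thesis using key[OF prod cop T] mod4 by blast
  next
    case 2
    have "T\<^sub>2 * T\<^sub>1 = q * S\<^sup>2" "coprime T\<^sub>2 T\<^sub>1" using prod cop by (simp_all add: mult.commute coprime_commute)
    then show ?thesis using key[OF _ _ T(2,1) 2] mod4 by blast
  qed
qed

lemma power_mod_eq_1:
  fixes a :: "'a :: euclidean_semiring_cancel"
  assumes "a mod m = 1"
  shows "a ^ n mod m = 1"
  using assms by (metis mod_mod_trivial power_mod power_one)

text \<open>Residues modulo 3 give p = 1 mod 3, so \<open>p\<close> is not 5. Then an even
  \<open>b\<close> = w/2 would make \<open>q\<close> divisible by 5. With \<open>b\<close> odd, P =
  p^b times \<open>p\<close> is a square and the second equation becomes the norm equation with X =
  2^h up to sign.\<close>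

lemma no_mixed_solution:
  fixes p q :: nat
  assumes p: "prime p" "p mod 8 = 5" and q: "prime q" "q mod 8 = 5"
    and eq1: "4 + p ^ w = q" "even w" "0 < w"
    and eq2: "2 ^ x + p ^ y = q ^ z" "even x" "3 \<le> x" "odd y" "odd z"
  shows False
proof -
  obtain b where b: "w = 2 * b" using eq1(2) by blast
  obtain h where h: "x = 2 * h" using eq2(2) by blast
  obtain k where k: "z = 2 * k + 1" using eq2(5) by (meson oddE)
  obtain m where m: "y = 2 * m + 1" using eq2(4) by (meson oddE)
  have p5: "5 \<le> p" using p(2) mod_less_eq_dividend[of p 8] by linarith
  have p_mod_3: "p mod 3 = 1"
  proof -
    have "\<not> 3 dvd p" using p5 p(1) primes_dvd_imp_eq[of 3 p] by auto
    then have p3: "p mod 3 = 1 \<or> p mod 3 = 2" by presburger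
    then have "p\<^sup>2 mod 3 = 1" by (auto simp: power_mod[symmetric, of p])
    then have "(p\<^sup>2) ^ b mod 3 = 1" by (rule power_mod_eq_1)
    then have "q mod 3 = 2" unfolding eq1(1)[symmetric] b power_mult by (simp add: mod_add_right_eq[symmetric])
    then have "q\<^sup>2 mod 3 = 1" by (simp add: power_mod[symmetric, of q])
    then have "(q\<^sup>2) ^ k mod 3 = 1" by (rule power_mod_eq_1)
    then have qz: "q ^ z mod 3 = 2" using \<open>q mod 3 = 2\<close> unfolding k power_add power_mult
      by (simp add: mod_mult_eq[symmetric, of _ q])
    have "(4::nat) ^ h mod 3 = 1" by (subst power_mod[symmetric]) simp
    then have tx: "2 ^ x mod 3 = (1::nat)" unfolding h by (simp add: power_mult)
    have "(p\<^sup>2) ^ m mod 3 = 1" using \<open>p\<^sup>2 mod 3 = 1\<close> by (rule power_mod_eq_1)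
    then have py: "p ^ y mod 3 = p mod 3" unfolding m power_add power_mult
      by (simp add: mod_mult_left_eq[symmetric, of _ p])
    have "(2 ^ x mod 3 + p ^ y mod 3) mod 3 = (2::nat)" unfolding mod_add_eq eq2(1) by (rule qz)
    then show ?thesis using p3 unfolding tx py by auto
  qed
  have "odd b"
  proof
    assume "even b"
    then obtain c where c: "w = 4 * c" using b by auto
    have "\<not> 5 dvd p" using p_mod_3 p(1) primes_dvd_imp_eq[of 5 p] by auto
    then have "p mod 5 \<in> {1, 2, 3, 4}" by (simp, presburger)
    then have "p ^ 4 mod 5 = 1" by (auto simp: power_mod[symmetric, of p])
    then have "(p ^ 4) ^ c mod 5 = 1" by (rule power_mod_eq_1)
    moreover have "q = 4 + (p ^ 4) ^ c" using eq1(1) unfolding c power_mult by simp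
    ultimately have "q mod 5 = 0" by presburger
    then have "q = 5" using q(1) primes_dvd_imp_eq[of 5 q] by (simp add: dvd_eq_mod_eq_0)
    then have "p ^ w = 1" using eq1(1) by simp
    then show False using p5 eq1(3) by simp
  qed
  then obtain l where l: "b = 2 * l + 1" by (meson oddE)
  have eq1': "int q = (int p ^ b)\<^sup>2 + 4" using eq1(1) by (simp add: b power_even_eq flip: eq1(1))
  have eq2': "int q * (int q ^ k)\<^sup>2 = X\<^sup>2 + int p * (int p ^ m)\<^sup>2" if "X\<^sup>2 = (2 ^ h)\<^sup>2" for X
  proof -
    have "int q ^ z = 2 ^ x + int p ^ y" using eq2(1) by (metis of_nat_add of_nat_numeral of_nat_power)
    then show ?thesis unfolding that h k m by (simp add: power_even_eq)
  qed
  have pi: "prime (int p)" "odd (int p)" "prime (int q)" and "odd q"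
    using p q by (simp, presburger, simp, presburger)
  \<comment> \<open>If both signs failed, \<open>p\<close> would divide 4 q^k.\<close>
  have "\<exists>X. X\<^sup>2 = (2 ^ h)\<^sup>2 \<and> 4 dvd X \<and> \<not> int p dvd X - 2 * int q ^ k"
  proof (rule ccontr)
    have "2 \<le> h" using eq2(3) h by simp
    then have four: "(4::int) dvd 2 ^ h" using le_imp_power_dvd[of 2 h "2::int"] by simp
    assume "\<not> ?thesis"
    then have "int p dvd 2 ^ h - 2 * int q ^ k" "int p dvd - (2 ^ h) - 2 * int q ^ k"
      using four by (metis, metis dvd_minus_iff power2_minus)
    then have "int p dvd (2 ^ h - 2 * int q ^ k) + (- (2 ^ h) - 2 * int q ^ k)" by (rule dvd_add)
    also have "\<dots> = - (2 ^ 2 * int q ^ k)" by simp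
    finally have "int p dvd 2 ^ 2 * int q ^ k" by (simp only: dvd_minus_iff)
    then have "int p dvd 2 \<or> int p dvd int q"
      using pi(1) prime_dvd_mult_iff prime_dvd_power by blast
    moreover have "\<not> int p dvd 2" using p5 zdvd_imp_le[of "int p" 2] by auto
    moreover have "\<not> p dvd q"
    proof
      assume "p dvd q"
      moreover have "p dvd p ^ w" using eq1(3) by simp
      ultimately have "p dvd 4" unfolding eq1(1)[symmetric] using dvd_add_left_iff by blast
      then show False using p5 dvd_imp_le[of p 4] by simp
    qed
    ultimately show False by simp
  qed
  then obtain X where X: "X\<^sup>2 = (2 ^ h)\<^sup>2" "4 dvd X" "\<not> int p dvd X - 2 * int q ^ k" by blast
  have qQ: "(int q * int q ^ k) mod 4 = 1"
  proof -
    have "int q mod 4 = 1" using q(2) by presburger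
    then have "int q ^ Suc k mod 4 = 1" by (rule power_mod_eq_1)
    then show ?thesis by simp
  qed
  show False
  proof (rule no_norm_equation_solution[OF pi(1,2,3) eq1' _ _ _ eq2'[OF X(1)] _ X(2) qQ _ _ X(3)])
    show "0 < int p ^ b" "0 < int q ^ k" using p5 q(2) by (simp_all, presburger)
    show "int p dvd int p ^ b" by (simp add: l)
    show "(int p ^ (l + 1))\<^sup>2 = int p ^ b * int p"
      unfolding l power_mult[symmetric] power_Suc2[symmetric] by (rule arg_cong[where f = "power (int p)"]) simp
    show "int p ^ m dvd int p ^ m" "int p ^ (l + 1) dvd int p ^ (l + 1)" by simp_all
  qed
qed

section \<open>Classification of the solutions and conclusion\<close>

text \<open>Residues modulo 4 exclude x = 1, and residues modulo 8 relate the parities of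
  \<open>y\<close> and \<open>z\<close>. An even \<open>z\<close> = 2n is excluded by factoring. For
  x = 2, q^n - 2 would be a power of \<open>p\<close>, yet it is 3 mod 4. For larger
  \<open>x\<close>, q^n + p^i would be a power of 2 that is 2 mod 4, hence 2, which is too
  small.\<close>

lemma solution_cases:
  fixes p q :: nat
  assumes p: "prime p" "p mod 8 = 5" and q: "prime q" "q mod 8 = 5"
    and eq: "2 ^ x + p ^ y = q ^ z" and pos: "0 < x" "0 < y" "0 < z"
  obtains "x = 2" "z = 1" "even y" | "3 \<le> x" "odd y" "odd z"
proof -
  have pm: "p ^ n mod 4 = 1" "q ^ n mod 4 = 1" for n
  proof -
    have "p mod 4 = 1" "q mod 4 = 1" using p(2) q(2) by presburger+
    then show "p ^ n mod 4 = 1" "q ^ n mod 4 = 1" by (simp_all add: power_mod_eq_1)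
  qed
  have pm8: "r ^ n mod 8 = (if even n then 1 else 5)" if "r mod 8 = 5" for r n :: nat
  proof (induction n)
    case (Suc n)
    have "r ^ Suc n mod 8 = (r mod 8) * (r ^ n mod 8) mod 8" by (simp add: mod_mult_eq)
    then show ?case using Suc that by auto
  qed simp
  have "x \<noteq> 1"
  proof
    assume "x = 1"
    then have "(2 + p ^ y) mod 4 = 1" using eq pm(2)[of z] by simp
    then show False using pm(1)[of y] by presburger
  qed
  then consider "x = 2" | "3 \<le> x" using pos(1) by linarith
  then show ?thesis
  proof cases
    case 1
    then have eq': "4 + p ^ y = q ^ z" using eq by simp
    have par: "even y \<longleftrightarrow> odd z"
      using eq' pm8[OF p(2), of y] pm8[OF q(2), of z] by (cases "even y"; cases "even z"; simp; presburger)
    have "odd z"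
    proof
      assume "even z"
      then obtain n where n: "z = 2 * n" by blast
      have "q ^ n mod 4 = 1" by (rule pm)
      moreover have "1 < q ^ n" using pos(3) n prime_gt_1_nat[OF q(1)] by (intro one_less_power) simp_all
      ultimately have qn: "5 \<le> q ^ n" by presburger
      obtain s where s: "q ^ n = s + 2" using qn le_Suc_ex[of 2 "q ^ n"] by (auto simp: add.commute)
      have "(s + 2) * (s + 2) = 4 + p ^ y" using eq' n s by (simp add: power_even_eq power2_eq_square)
      then have "s * (s + 4) = p ^ y" by (simp add: algebra_simps)
      then have "s dvd p ^ y" by (metis dvd_triv_left)
      then obtain i where "s = p ^ i" using divides_primepow_nat[OF p(1)] by blast
      then have "s mod 4 = 1" using pm by simp
      then show False using \<open>q ^ n mod 4 = 1\<close> unfolding s by presburger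
    qed
    moreover have "odd q" using q(2) by presburger
    ultimately have "z = 1" using four_plus_even_prime_power[OF p q(1) _ eq'] par pos(2) by blast
    then show ?thesis using 1 par that(1) by simp
  next
    case 2
    then obtain v where "x = 3 + v" using le_Suc_ex by blast
    then have v: "8 * 2 ^ v + p ^ y = q ^ z" using eq by (simp add: power_add)
    have "p ^ y mod 8 = q ^ z mod 8" unfolding v[symmetric] by simp
    then have par: "even y \<longleftrightarrow> even z"
      unfolding pm8[OF p(2)] pm8[OF q(2)] by (simp split: if_splits)
    have "odd z"
    proof
      assume "even z"
      then obtain n i where n: "z = 2 * n" "y = 2 * i" using par by blast
      have less: "p ^ i < q ^ n"
      proof (rule power_less_imp_less_base)
        show "(p ^ i)\<^sup>2 < (q ^ n)\<^sup>2" using eq n by (metis power_even_eq less_add_same_cancel2 zero_less_power zero_less_numeral)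
      qed simp
      obtain s where s: "q ^ n = p ^ i + s" using less le_Suc_ex[of "p ^ i" "q ^ n"] by auto
      have "2 ^ x + p ^ i * p ^ i = q ^ n * q ^ n" using eq n by (simp add: power_even_eq power2_eq_square)
      also have "\<dots> = (q ^ n + p ^ i) * s + p ^ i * p ^ i" unfolding s by (simp add: algebra_simps)
      finally have "2 ^ x = (q ^ n + p ^ i) * s" by simp
      then have "q ^ n + p ^ i dvd 2 ^ x" by (metis dvd_triv_left)
      then obtain j where j: "q ^ n + p ^ i = 2 ^ j" using divides_primepow_nat[OF two_is_prime_nat] by blast
      have two: "(q ^ n + p ^ i) mod 4 = 2" using pm(1)[of i] pm(2)[of n] by presburger
      have "j < 2"
      proof (rule ccontr)
        assume "\<not> j < 2"
        then have "2\<^sup>2 dvd (2::nat) ^ j" by (intro le_imp_power_dvd) simp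
        then show False using two unfolding j by (simp add: dvd_eq_mod_eq_0)
      qed
      then have "(2::nat) ^ j \<le> 2 ^ 1" by (intro power_increasing) simp_all
      moreover have "0 < p ^ i" using p(1) prime_gt_0_nat by simp
      ultimately show False using j less unfolding power_one_right by linarith
    qed
    then show ?thesis using 2 par that(2) by simp
  qed
qed

theorem proposition3p1:
  fixes p q :: nat
  assumes "prime p" and "prime q"
    and "[p = 5] (mod 8)" and "[q = 5] (mod 8)"
  shows "\<exists>\<^sub>\<le>\<^sub>1 (x, y, z). 0 < (x::nat) \<and> 0 < (y::nat) \<and> 0 < (z::nat) \<and> 2 ^ x + p ^ y = q ^ z"
proof -
  have p: "prime p" "p mod 8 = 5" and q: "prime q" "q mod 8 = 5"
    using assms by (simp_all add: cong_def)
  have p3: "3 < p" using p(2) mod_less_eq_dividend[of p 8] by linarith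
  have "odd q" using q(2) by presburger
  let ?sol = "\<lambda>x y z. 0 < (x::nat) \<and> 0 < (y::nat) \<and> 0 < (z::nat) \<and> 2 ^ x + p ^ y = q ^ z"
  have residue: "[2 ^ x = int q ^ z] (mod int p)" if "?sol x y z" for x y z
  proof -
    have "int q ^ z - 2 ^ x = int p ^ y"
      using that by (metis add_diff_cancel_left' of_nat_add of_nat_numeral of_nat_power)
    then have "int p dvd int q ^ z - 2 ^ x" using that by simp
    then show ?thesis by (metis cong_iff_dvd_diff cong_sym)
  qed
  have pq: "p \<noteq> q" if "?sol x y z" for x y z
  proof
    assume "p = q"
    then have "p dvd 2 ^ x + p ^ y" "p dvd p ^ y" using that by simp_all
    then have "p dvd 2 ^ x" by (metis dvd_add_left_iff)
    then have "p dvd 2" using p(1) prime_dvd_power by blast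
    then show False using p3 dvd_imp_le[of p 2] by simp
  qed
  have mixed: False if "?sol x y z" "?sol x' y' z'" "x = 2" "z = 1" "even y" "3 \<le> x'" "odd y'" "odd z'"
    for x y z x' y' z'
  proof -
    \<comment> \<open>Both \<open>z\<close> exponents are odd, so \<open>x'\<close> inherits the
      parity of x = 2.\<close>
    have "even (z + z')" using that by simp
    then have "even (x + x')"
      by (rule even_exponent_sum[OF p residue[OF that(1)] residue[OF that(2)]])
    then have "even x'" using that(3) by simp
    moreover have "4 + p ^ y = q" using that by simp
    ultimately show False using no_mixed_solution[OF p q] that by blast
  qed
  have unique: "(x, y, z) = (x', y', z')" if s: "?sol x y z" "?sol x' y' z'" for x y z x' y' z'
  proof -
    have pos: "0 < x" "0 < y" "0 < z" "2 ^ x + p ^ y = q ^ z"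
      and pos': "0 < x'" "0 < y'" "0 < z'" "2 ^ x' + p ^ y' = q ^ z'" using s by auto
    show ?thesis
    proof (cases rule: solution_cases[OF p q pos(4,1,2,3)])
      case c: 1
      show ?thesis
      proof (cases rule: solution_cases[OF p q pos'(4,1,2,3)])
        case 1
        then have "p ^ y = p ^ y'" using c pos(4) pos'(4) by simp
        then show ?thesis using 1 c p3 by (simp add: power_inject_exp)
      next
        case 2
        then show ?thesis using mixed[OF s c] by blast
      qed
    next
      case c: 2
      show ?thesis
      proof (cases rule: solution_cases[OF p q pos'(4,1,2,3)])
        case 1
        then show ?thesis using mixed[OF s(2,1) 1 c] by blast
      next
        case 2
        have "even (x + x')"
          using even_exponent_sum[OF p residue[OF s(1)] residue[OF s(2)]] 2 c by simp
        then show ?thesis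
          using odd_solution_unique[OF p(1) p3 q(1) \<open>odd q\<close> pq[OF s(1)] pos(4) c(2,3) pos'(4) 2(2,3)] by blast
      qed
    qed
  qed
  show ?thesis
  proof (rule Uniq_I)
    fix s t
    assume "case s of (x, y, z) \<Rightarrow> ?sol x y z" "case t of (x, y, z) \<Rightarrow> ?sol x y z"
    moreover obtain x y z where "s = (x, y, z)" by (rule prod_cases3)
    moreover obtain x' y' z' where "t = (x', y', z')" by (rule prod_cases3)
    ultimately show "t = s" using unique[of x' y' z' x y z] by simp
  qed
qed

end
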